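(* Assume that A1, A2 and A3 hold, and let $f(\theta)=\mathcal{T}_c(\rho(\cdot,\theta),\rho^* )$ for $\theta\in\Theta$. (i) $f$ is directionally differentiable at every point of $\Theta$, and $$f'(\theta_0,\Delta\theta)=\sup_{(\phi,\phi^c)\in\mathcal{S}(\theta_0)}\int_\Omega \phi(x)\,\nabla_\theta\rho(x,\theta_0)\,dx\cdot\Delta\theta$$ for all $\theta_0\in\Theta$ and $\Delta\theta\in\mathbb{R}^m$. (ii) $f$ is Gâteaux differentiable at $\theta_0\in\Theta$ if and only if $$\int_\Omega \phi_1(x)\nabla_\theta\rho(x,\theta_0)\,dx=\int_\Omega \phi_2(x)\nabla_\theta\rho(x,\theta_0)\,dx$$ for all $(\phi_1,\phi_1^c),(\phi_2,\phi_2^c)\in\mathcal{S}(\theta_0)$. In this case, $$\nabla f(\theta_0)=\int_\Omega\phi(x)\nabla_\theta\rho(x,\theta_0)\,dx$$ for an arbitrary pair of Kantorovich potentials $(\phi,\psi)\in\Phi_c(\rho(\cdot,\theta_0),\rho^* )$ for the transport from $\rho(\cdot,\theta_0)$ to $\rho^*$.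
   Context: Setting: $\Omega\subset\mathbb{R}^d$ is compact, $\mathscr{P}(\Omega)$ is the set of Borel probability measures on $\Omega$, and $\rho^*\in\mathscr{P}(\Omega)$ is arbitrary. Assumptions. A1: $\Theta\subset\mathbb{R}^m$ is open, and $\{\rho(\cdot,\theta)\}_{\theta\in\Theta}\subset\mathscr{P}(\Omega)$ is a family of absolutely continuous (w.r.t. Lebesgue measure) probability measures; the same symbol denotes the measure and its density. A2: for a.e. $x\in\Omega$ the map $\theta\mapsto\rho(x,\theta)$ is differentiable, and $|\nabla_\theta\rho(x,\theta)|\le\eta(x)$ for all $\theta\in\Theta$, for some $\eta\in L^1(\Omega)$. A3: $c:\Omega^2\to\mathbb{R}$ is continuous and nonnegative. Optimal transport cost: for $\mu,\nu\in\mathscr{P}(\Omega)$, $\mathcal{T}_c(\mu,\nu)=\inf_\pi\int_{\Omega\times\Omega}c\,d\pi$ over all $\pi\in\mathscr{P}(\Omega\times\Omega)$ with marginals $\mu$ and $\nu$. Duality: $\Phi_c(\mu,\nu)\subset C(\Omega)\times C(\Omega)$ is the set of pairs $(\phi,\psi)$ with $\phi(x)+\psi(y)\le c(x,y)$ for all $(x,y)\in\Omega^2$. Kantorovich duality states $\mathcal{T}_c(\mu,\nu)=\sup_{(\phi,\psi)\in\Phi_c(\mu,\nu)}\int\phi\,d\mu+\int\psi\,d\nu$; maximizing pairs are called Kantorovich potentials. The $c$-transforms are $\phi^c(y)=\inf_{x\in\Omega}\{c(x,y)-\phi(x)\}$ and $\psi^c(x)=\inf_{y\in\Omega}\{c(x,y)-\psi(y)\}$,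 and $\phi^{cc}=(\phi^c)^c$. $K_c$ is the set of pairs $(\phi,\phi^c)\in C(\Omega)\times C(\Omega)$ with $\phi=\phi^{cc}$, $0\le\phi\le\|c\|_\infty$, and $-\|c\|_\infty\le\phi^c\le0$. $\mathcal{S}(\theta)\subset K_c$ is the set of those pairs in $K_c$ that are Kantorovich potentials for the optimal transport from $\rho(\cdot,\theta)$ to $\rho^*$. Differentiability: $f$ is directionally differentiable at $\theta_0$ if $f'(\theta_0,\Delta\theta)=\lim_{t\to0+}\frac{f(\theta_0+t\Delta\theta)-f(\theta_0)}{t}$ exists for all $\Delta\theta\in\mathbb{R}^m$. If moreover $\Delta\theta\mapsto f'(\theta_0,\Delta\theta)$ is linear, $f$ is Gâteaux differentiable at $\theta_0$, and $\nabla f(\theta_0)$ denotes the vector generating this linear map. *)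

theory Defs
  imports "HOL-Probability.Probability"
begin

section \<open>Probability measures, densities and optimal transport\<close>

definition borel_prob :: "'a::topological_space set \<Rightarrow> 'a measure set" where
  "borel_prob X = {\<mu>. prob_space \<mu> \<and> space \<mu> = X \<and> sets \<mu> = sets (restrict_space borel X)}"

text \<open>The density may be any Lebesgue measurable representative of the Radon--Nikodym
  derivative, not only a Borel one. It is a real function (it gets differentiated in a
  parameter below); since \<^const>\<open>ennreal\<close> truncates negative values, nonnegativity is
  required separately.\<close>

definition has_lebesgue_density :: "'a::euclidean_space set \<Rightarrow> 'a measure \<Rightarrow> ('a \<Rightarrow> real) \<Rightarrow> bool" where
  "has_lebesgue_density X \<mu> r \<longleftrightarrow>
     r \<in> borel_measurable (lebesgue_on X) \<and>
     (AE x in lebesgue_on X. 0 \<le> r x) \<and>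
     (\<forall>A\<in>sets \<mu>. emeasure \<mu> A = (\<integral>\<^sup>+x\<in>A. ennreal (r x) \<partial>lebesgue_on X))"

definition couplings ::
  "'a::topological_space set \<Rightarrow> 'a measure \<Rightarrow> 'a measure \<Rightarrow> ('a \<times> 'a) measure set" where
  "couplings X \<mu> \<nu> = {\<pi> \<in> borel_prob (X \<times> X).
     distr \<pi> (restrict_space borel X) fst = \<mu> \<and> distr \<pi> (restrict_space borel X) snd = \<nu>}"

definition transport_cost ::
  "'a::topological_space set \<Rightarrow> ('a \<Rightarrow> 'a \<Rightarrow> real) \<Rightarrow> 'a measure \<Rightarrow> 'a measure \<Rightarrow> real" where
  "transport_cost X c \<mu> \<nu> = (INF \<pi>\<in>couplings X \<mu> \<nu>. \<integral>(x, y). c x y \<partial>\<pi>)"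


section \<open>Kantorovich potentials\<close>

text \<open>Elements of \<open>C(X)\<close> are represented by functions on the whole type that are continuous
  on \<open>X\<close>. Their values outside \<open>X\<close> are irrelevant, and all (in)equalities between them are
  only required on \<open>X\<close>.\<close>

definition dual_pairs ::
  "'a::topological_space set \<Rightarrow> ('a \<Rightarrow> 'a \<Rightarrow> real) \<Rightarrow> (('a \<Rightarrow> real) \<times> ('a \<Rightarrow> real)) set" where
  "dual_pairs X c = {(\<phi>, \<psi>). continuous_on X \<phi> \<and> continuous_on X \<psi> \<and>
     (\<forall>x\<in>X. \<forall>y\<in>X. \<phi> x + \<psi> y \<le> c x y)}"

definition dual_value ::
  "'a measure \<Rightarrow> 'a measure \<Rightarrow> ('a \<Rightarrow> real) \<times> ('a \<Rightarrow> real) \<Rightarrow> real" where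
  "dual_value \<mu> \<nu> = (\<lambda>(\<phi>, \<psi>). (\<integral>x. \<phi> x \<partial>\<mu>) + (\<integral>y. \<psi> y \<partial>\<nu>))"

definition kantorovich_potentials ::
  "'a::topological_space set \<Rightarrow> ('a \<Rightarrow> 'a \<Rightarrow> real) \<Rightarrow> 'a measure \<Rightarrow> 'a measure \<Rightarrow>
     (('a \<Rightarrow> real) \<times> ('a \<Rightarrow> real)) set" where
  "kantorovich_potentials X c \<mu> \<nu> =
     {p \<in> dual_pairs X c. \<forall>q\<in>dual_pairs X c. dual_value \<mu> \<nu> q \<le> dual_value \<mu> \<nu> p}"

text \<open>The two \<open>c\<close>-transforms: \<open>ctrans\<close> takes the infimum over the first argument of \<open>c\<close>,
  \<open>ctrans'\<close> over the second one.\<close>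

definition ctrans :: "'a set \<Rightarrow> ('a \<Rightarrow> 'a \<Rightarrow> real) \<Rightarrow> ('a \<Rightarrow> real) \<Rightarrow> 'a \<Rightarrow> real" where
  "ctrans X c \<phi> y = (INF x\<in>X. c x y - \<phi> x)"

definition ctrans' :: "'a set \<Rightarrow> ('a \<Rightarrow> 'a \<Rightarrow> real) \<Rightarrow> ('a \<Rightarrow> real) \<Rightarrow> 'a \<Rightarrow> real" where
  "ctrans' X c \<psi> x = (INF y\<in>X. c x y - \<psi> y)"

definition sup_norm_on :: "'a set \<Rightarrow> ('a \<Rightarrow> 'a \<Rightarrow> real) \<Rightarrow> real" where
  "sup_norm_on X c = (SUP (x, y)\<in>X \<times> X. \<bar>c x y\<bar>)"

definition normalized_pairs ::
  "'a::topological_space set \<Rightarrow> ('a \<Rightarrow> 'a \<Rightarrow> real) \<Rightarrow> (('a \<Rightarrow> real) \<times> ('a \<Rightarrow> real)) set" where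
  "normalized_pairs X c = {(\<phi>, ctrans X c \<phi>) | \<phi>.
     continuous_on X \<phi> \<and> continuous_on X (ctrans X c \<phi>) \<and>
     (\<forall>x\<in>X. \<phi> x = ctrans' X c (ctrans X c \<phi>) x) \<and>
     (\<forall>x\<in>X. 0 \<le> \<phi> x \<and> \<phi> x \<le> sup_norm_on X c) \<and>
     (\<forall>y\<in>X. - sup_norm_on X c \<le> ctrans X c \<phi> y \<and> ctrans X c \<phi> y \<le> 0)}"

definition normalized_potentials ::
  "'a::topological_space set \<Rightarrow> ('a \<Rightarrow> 'a \<Rightarrow> real) \<Rightarrow> 'a measure \<Rightarrow> 'a measure \<Rightarrow>
     (('a \<Rightarrow> real) \<times> ('a \<Rightarrow> real)) set" where
  "normalized_potentials X c \<mu> \<nu> = normalized_pairs X c \<inter> kantorovich_potentials X c \<mu> \<nu>"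


section \<open>Differentiability\<close>

definition directionally_differentiable :: "('a::real_normed_vector \<Rightarrow> real) \<Rightarrow> 'a \<Rightarrow> bool" where
  "directionally_differentiable f x \<longleftrightarrow>
     (\<forall>v. \<exists>l. ((\<lambda>t. (f (x + t *\<^sub>R v) - f x) / t) \<longlongrightarrow> l) (at_right 0))"

definition dir_deriv :: "('a::real_normed_vector \<Rightarrow> real) \<Rightarrow> 'a \<Rightarrow> 'a \<Rightarrow> real" where
  "dir_deriv f x v = Lim (at_right 0) (\<lambda>t. (f (x + t *\<^sub>R v) - f x) / t)"

definition gateaux_differentiable :: "('a::real_normed_vector \<Rightarrow> real) \<Rightarrow> 'a \<Rightarrow> bool" where
  "gateaux_differentiable f x \<longleftrightarrow> directionally_differentiable f x \<and> linear (dir_deriv f x)"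

definition gateaux_gradient :: "('a::real_inner \<Rightarrow> real) \<Rightarrow> 'a \<Rightarrow> 'a" where
  "gateaux_gradient f x = (THE g. \<forall>v. dir_deriv f x v = g \<bullet> v)"

text \<open>Gradient of a Frechet differentiable function. It is unspecified at points where the
  function is not differentiable.\<close>

definition gradient :: "('a::real_inner \<Rightarrow> real) \<Rightarrow> 'a \<Rightarrow> 'a" where
  "gradient f x = (THE g. GDERIV f x :> g)"

text \<open>The vector \<open>\<integral> \<phi>(x) \<nabla>\<^sub>\<theta>\<rho>(x,\<theta>) dx\<close>. The integral is taken with respect to the completed
  measure, since the gradient is only specified almost everywhere.\<close>

definition weighted_gradient ::
  "'a::euclidean_space set \<Rightarrow> ('a \<Rightarrow> 'b::euclidean_space \<Rightarrow> real) \<Rightarrow> 'b \<Rightarrow> ('a \<Rightarrow> real) \<Rightarrow> 'b" where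
  "weighted_gradient X \<rho> \<theta> \<phi> = (\<integral>x. \<phi> x *\<^sub>R gradient (\<rho> x) \<theta> \<partial>lebesgue_on X)"

end

theory Submission
  imports Defs "HOL-Complex_Analysis.Great_Picard"
begin

text \<open>
  Let \<open>\<nu>\<close> be the target measure, \<open>X\<close> the compact space, and write \<open>J(\<theta>, \<phi>, \<psi>) = \<integral>\<phi> dP(\<theta>) + \<integral>\<psi> d\<nu>\<close>.
  By Kantorovich duality \<open>f(\<theta>)\<close> is the maximum of \<open>J(\<theta>, \<cdot>)\<close> over the dual pairs, and replacing a dual pair by suitably shifted \<open>c\<close>-transforms
  (\<open>dual_pair_improve\<close>) shows that the maximum may be taken over the set \<open>K\<close> of normalized
  pairs, which does not depend on \<open>\<theta>\<close>. The transforms inherit the modulus of continuity of \<open>c\<close>, so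
  \<open>K\<close> is compact for uniform convergence by Arzela--Ascoli (\<open>normalized_pairs_compact\<close>). Thus \<open>f\<close> is
  a maximum of functions of \<open>\<theta>\<close> over a compact set, and the formula for its directional derivatives
  is that of Danskin's theorem.

  For the lower bound, a maximizer at \<open>\<theta>\<^sub>0\<close> is a competitor at every other parameter, so the
  difference quotient of \<open>f\<close> dominates that of \<open>J(\<cdot>, \<phi>, \<psi>)\<close> (\<open>potential_subgradient\<close>). For the upper
  bound, maximizers at \<open>\<theta>\<^sub>0 + t\<^sub>n v\<close> are competitors at \<open>\<theta>\<^sub>0\<close>; along a subsequence they converge in
  \<open>K\<close> to a maximizer at \<open>\<theta>\<^sub>0\<close> (\<open>limit_potential_bounds_quotient\<close>). Both need that difference
  quotients of \<open>\<integral>\<phi>\<^sub>n dP(\<theta>)\<close> converge when \<open>\<phi>\<^sub>n\<close> does; this is dominated convergence, the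
  majorant coming from the mean value inequality and the bound \<open>\<eta>\<close> on the gradients
  (\<open>source_quotient_tendsto\<close>). If the directional derivative is linear, then the inequality of
  the lower bound in the directions \<open>v\<close> and \<open>-v\<close> becomes an equality, for every Kantorovich
  potential, normalized or not; this gives the statements on Gateaux differentiability.

  Kantorovich duality itself is obtained by discretization. Round points of \<open>X\<close> to a finite
  net. On the net, transport is a finite linear program whose duality follows from the Farkas
  lemma (\<open>discrete_transport_duality\<close>). An optimal discrete plan is spread out inside the cells,
  proportionally to \<open>\<mu> \<times> \<nu>\<close>, which yields an exact coupling of \<open>\<mu>\<close> and \<open>\<nu>\<close>; conversely,
  \<open>c\<close>-transforms turn discrete potentials into continuous ones. Both steps change values only by
  the oscillation of \<open>c\<close> over the cells (\<open>coupling_near_dual_bound\<close>).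
\<close>

section \<open>c-Transforms on a compact space\<close>

lemma abs_cINF_diff_le:
  fixes f g :: "'a \<Rightarrow> real"
  assumes "A \<noteq> {}" "bdd_below (f ` A)" "bdd_below (g ` A)"
    and e: "\<And>x. x \<in> A \<Longrightarrow> \<bar>f x - g x\<bar> \<le> e"
  shows "\<bar>(INF x\<in>A. f x) - (INF x\<in>A. g x)\<bar> \<le> e"
proof -
  have "(INF x\<in>A. f x) - e \<le> g x" if "x \<in> A" for x
    using cINF_lower[OF assms(2) that] e[OF that] by linarith
  then have "(INF x\<in>A. f x) - e \<le> (INF x\<in>A. g x)"
    by (intro cINF_greatest assms)
  moreover have "(INF x\<in>A. g x) - e \<le> f x" if "x \<in> A" for x
    using cINF_lower[OF assms(3) that] e[OF that] by linarith
  then have "(INF x\<in>A. g x) - e \<le> (INF x\<in>A. f x)"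
    by (intro cINF_greatest assms)
  ultimately show ?thesis by linarith
qed

text \<open>The second transform is the first one for the cost with exchanged arguments, so every
  fact about \<^const>\<open>ctrans\<close> has a mirror image for \<^const>\<open>ctrans'\<close>.\<close>

lemma ctrans'_eq_ctrans_flip: "ctrans' S c = ctrans S (\<lambda>x y. c y x)"
  by (simp add: fun_eq_iff ctrans_def ctrans'_def)

lemma borel_probD:
  assumes "\<mu> \<in> borel_prob X"
  shows "prob_space \<mu>" "space \<mu> = X" "sets \<mu> = sets (restrict_space borel X)"
  using assms by (auto simp: borel_prob_def)

lemma borel_measurable_borel_prob:
  fixes g :: "'a::topological_space \<Rightarrow> 'b::topological_space"
  assumes "\<mu> \<in> borel_prob X" "continuous_on X g"
  shows "g \<in> borel_measurable \<mu>"
  using borel_measurable_continuous_on_restrict[OF assms(2)] borel_probD(3)[OF assms(1)]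
  by (simp cong: measurable_cong_sets)

lemma integrable_borel_prob_bounded:
  fixes g :: "'a::topological_space \<Rightarrow> real"
  assumes \<mu>: "\<mu> \<in> borel_prob X" and g: "g \<in> borel_measurable \<mu>"
    and B: "\<And>x. x \<in> X \<Longrightarrow> \<bar>g x\<bar> \<le> B"
  shows "integrable \<mu> g"
proof -
  interpret prob_space \<mu> using \<mu> by (rule borel_probD)
  show ?thesis
    by (rule integrable_const_bound[of _ B]) (use g B borel_probD(2)[OF \<mu>] in auto)
qed

lemma integrable_borel_prob_continuous:
  fixes g :: "'a::topological_space \<Rightarrow> real"
  assumes \<mu>: "\<mu> \<in> borel_prob X" and X: "compact X" and g: "continuous_on X g"
  shows "integrable \<mu> g"
proof -
  have "bounded (g ` X)"
    using compact_continuous_image[OF g X] by (rule compact_imp_bounded)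
  then obtain B where "\<And>x. x \<in> X \<Longrightarrow> \<bar>g x\<bar> \<le> B"
    by (auto simp: bounded_iff)
  then show ?thesis
    using integrable_borel_prob_bounded[OF \<mu> borel_measurable_borel_prob[OF \<mu> g]] by blast
qed

lemma integral_borel_prob_tendsto:
  fixes g :: "nat \<Rightarrow> 'a::topological_space \<Rightarrow> real"
  assumes \<mu>: "\<mu> \<in> borel_prob X"
    and g: "\<And>n. continuous_on X (g n)" "continuous_on X h"
    and B: "\<And>n x. x \<in> X \<Longrightarrow> \<bar>g n x\<bar> \<le> B"
    and lim: "\<And>x. x \<in> X \<Longrightarrow> (\<lambda>n. g n x) \<longlonglongrightarrow> h x"
  shows "(\<lambda>n. \<integral>x. g n x \<partial>\<mu>) \<longlonglongrightarrow> (\<integral>x. h x \<partial>\<mu>)"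
proof -
  interpret prob_space \<mu> using \<mu> by (rule borel_probD)
  show ?thesis
  proof (rule integral_dominated_convergence[where w = "\<lambda>_. B"])
    show "h \<in> borel_measurable \<mu>" "g n \<in> borel_measurable \<mu>" for n
      using g by (auto intro: borel_measurable_borel_prob[OF \<mu>])
  qed (use B lim borel_probD(2)[OF \<mu>] in auto)
qed

locale compact_cost =
  fixes X :: "'a::euclidean_space set" and c :: "'a \<Rightarrow> 'a \<Rightarrow> real"
  assumes compact_space: "compact X"
    and nonempty: "X \<noteq> {}"
    and continuous_cost: "continuous_on (X \<times> X) (\<lambda>(x, y). c x y)"
    and cost_nonneg: "\<And>x y. x \<in> X \<Longrightarrow> y \<in> X \<Longrightarrow> 0 \<le> c x y"
begin

lemma flip: "compact_cost X (\<lambda>x y. c y x)"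
proof -
  have "continuous_on (X \<times> X) ((\<lambda>(x, y). c x y) \<circ> (\<lambda>p. (snd p, fst p)))"
    by (rule continuous_on_compose)
      (auto intro!: continuous_intros continuous_on_subset[OF continuous_cost])
  then show ?thesis
    using compact_space nonempty cost_nonneg
    by unfold_locales (auto simp: o_def case_prod_unfold)
qed

lemma uniform_cost:
  assumes "e > 0"
  obtains d where "d > 0"
    "\<And>x x' y y'. \<lbrakk>x \<in> X; x' \<in> X; y \<in> X; y' \<in> X; dist x x' < d; dist y y' < d\<rbrakk>
       \<Longrightarrow> \<bar>c x y - c x' y'\<bar> < e"
proof -
  have "uniformly_continuous_on (X \<times> X) (\<lambda>(x, y). c x y)"
    by (intro compact_uniformly_continuous continuous_cost compact_Times compact_space)
  then obtain d where d: "d > 0"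
    "\<And>p p'. \<lbrakk>p \<in> X \<times> X; p' \<in> X \<times> X; dist p' p < d\<rbrakk>
        \<Longrightarrow> dist (case p' of (x, y) \<Rightarrow> c x y) (case p of (x, y) \<Rightarrow> c x y) < e"
    using assms unfolding uniformly_continuous_on_def by meson
  show ?thesis
  proof (rule that[of "d / 2"])
    fix x x' y y' assume *: "x \<in> X" "x' \<in> X" "y \<in> X" "y' \<in> X" "dist x x' < d / 2" "dist y y' < d / 2"
    have "dist (x, y) (x', y') \<le> dist x x' + dist y y'"
      unfolding dist_prod_def by (simp add: sqrt_sum_squares_le_sum)
    then show "\<bar>c x y - c x' y'\<bar> < e"
      using d(2)[of "(x', y')" "(x, y)"] * by (auto simp: dist_real_def)
  qed (use d in auto)
qed

lemma cost_le_sup_norm: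
  assumes "x \<in> X" "y \<in> X" shows "c x y \<le> sup_norm_on X c"
proof -
  have "bounded ((\<lambda>(x, y). c x y) ` (X \<times> X))"
    by (intro compact_imp_bounded compact_continuous_image continuous_cost compact_Times compact_space)
  then obtain B where B: "\<And>x y. x \<in> X \<Longrightarrow> y \<in> X \<Longrightarrow> \<bar>c x y\<bar> \<le> B"
    unfolding bounded_iff by (force simp: real_norm_def)
  have "\<bar>c x y\<bar> \<le> sup_norm_on X c"
    unfolding sup_norm_on_def
    by (rule cSUP_upper2[of _ _ "(x, y)"]) (use assms B in \<open>auto intro!: bdd_aboveI[of _ B]\<close>)
  then show ?thesis by simp
qed

lemma ctrans_bdd_below:
  assumes "S \<subseteq> X" "bdd_above (\<phi> ` S)" "y \<in> X"
  shows "bdd_below ((\<lambda>x. c x y - \<phi> x) ` S)"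
proof -
  obtain B where "\<And>x. x \<in> S \<Longrightarrow> \<phi> x \<le> B"
    using assms(2) by (auto simp: bdd_above_def)
  then show ?thesis
    using assms cost_nonneg by (intro bdd_belowI[of _ "- B"]) (force simp: subset_iff)
qed

lemma ctrans_le:
  assumes "S \<subseteq> X" "bdd_above (\<phi> ` S)" "x \<in> S" "y \<in> X"
  shows "ctrans S c \<phi> y \<le> c x y - \<phi> x"
  unfolding ctrans_def using ctrans_bdd_below[OF assms(1,2,4)] assms(3) by (rule cINF_lower)

lemma ctrans_greatest:
  assumes "S \<noteq> {}" "\<And>x. x \<in> S \<Longrightarrow> m \<le> c x y - \<phi> x"
  shows "m \<le> ctrans S c \<phi> y"
  unfolding ctrans_def using assms by (rule cINF_greatest)

text \<open>For fixed \<open>x\<close> the functions \<open>y \<mapsto> c x y - \<phi> x\<close> share a modulus of continuity that does not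
  involve \<open>\<phi>\<close>, and an infimum keeps it. That \<open>d\<close> depends neither on \<open>\<phi>\<close> nor on \<open>S\<close> is what makes
  Arzela--Ascoli applicable. The infimum runs over a subset \<open>S\<close> of \<open>X\<close> because finite nets are needed
  for the duality theorem.\<close>

lemma ctrans_equicontinuous:
  assumes "e > 0"
  shows "\<exists>d>0. \<forall>S \<phi>. S \<subseteq> X \<longrightarrow> S \<noteq> {} \<longrightarrow> bdd_above (\<phi> ` S) \<longrightarrow>
    (\<forall>y\<in>X. \<forall>y'\<in>X. dist y y' < d \<longrightarrow> \<bar>ctrans S c \<phi> y - ctrans S c \<phi> y'\<bar> < e)"
proof -
  obtain d where d: "d > 0"
    "\<And>x x' y y'. \<lbrakk>x \<in> X; x' \<in> X; y \<in> X; y' \<in> X; dist x x' < d; dist y y' < d\<rbrakk>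
       \<Longrightarrow> \<bar>c x y - c x' y'\<bar> < e / 2"
    using uniform_cost[of "e / 2"] assms by auto
  have "\<bar>ctrans S c \<phi> y - ctrans S c \<phi> y'\<bar> < e"
    if S: "S \<subseteq> X" "S \<noteq> {}" "bdd_above (\<phi> ` S)" and y: "y \<in> X" "y' \<in> X" "dist y y' < d" for S \<phi> y y'
  proof -
    have "\<bar>ctrans S c \<phi> y - ctrans S c \<phi> y'\<bar> \<le> e / 2"
      unfolding ctrans_def
    proof (rule abs_cINF_diff_le)
      show "bdd_below ((\<lambda>x. c x y - \<phi> x) ` S)" "bdd_below ((\<lambda>x. c x y' - \<phi> x) ` S)"
        using S y by (simp_all add: ctrans_bdd_below)
      fix x assume "x \<in> S"
      then have "\<bar>c x y - c x y'\<bar> < e / 2"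
        using d(1) S y by (intro d(2)) auto
      then show "\<bar>(c x y - \<phi> x) - (c x y' - \<phi> x)\<bar> \<le> e / 2"
        by simp
    qed (rule S)
    then show ?thesis using assms by linarith
  qed
  with d(1) show ?thesis by (intro exI[of _ d]) simp
qed

lemma continuous_on_ctrans:
  assumes S: "S \<subseteq> X" "S \<noteq> {}" "bdd_above (\<phi> ` S)"
  shows "continuous_on X (ctrans S c \<phi>)"
  unfolding continuous_on_iff
proof (intro ballI allI impI)
  fix y and e :: real assume y: "y \<in> X" and "0 < e"
  obtain d where d: "d > 0"
    "\<forall>S \<phi>. S \<subseteq> X \<longrightarrow> S \<noteq> {} \<longrightarrow> bdd_above (\<phi> ` S) \<longrightarrow>
      (\<forall>y\<in>X. \<forall>y'\<in>X. dist y y' < d \<longrightarrow> \<bar>ctrans S c \<phi> y - ctrans S c \<phi> y'\<bar> < e)"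
    using ctrans_equicontinuous[OF \<open>0 < e\<close>] by auto
  then show "\<exists>d>0. \<forall>x'\<in>X. dist x' y < d \<longrightarrow> dist (ctrans S c \<phi> x') (ctrans S c \<phi> y) < e"
    using d(2)[rule_format, OF S _ y] d(1) by (intro exI[of _ d]) (simp add: dist_real_def)
qed

lemmas ctrans'_le = compact_cost.ctrans_le[OF flip, folded ctrans'_eq_ctrans_flip]
lemmas ctrans'_greatest = compact_cost.ctrans_greatest[OF flip, folded ctrans'_eq_ctrans_flip]
lemmas ctrans'_equicontinuous = compact_cost.ctrans_equicontinuous[OF flip, folded ctrans'_eq_ctrans_flip]
lemmas continuous_on_ctrans' = compact_cost.continuous_on_ctrans[OF flip, folded ctrans'_eq_ctrans_flip]

lemma bdd_above_continuous:
  fixes \<phi> :: "'a \<Rightarrow> real"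
  assumes "continuous_on X \<phi>" shows "bdd_above (\<phi> ` X)"
  using compact_continuous_image[OF assms compact_space] by (simp add: bounded_imp_bdd_above compact_imp_bounded)

lemma normalized_pairs_iff:
  "(\<phi>, \<psi>) \<in> normalized_pairs X c \<longleftrightarrow> \<psi> = ctrans X c \<phi> \<and> continuous_on X \<phi> \<and> continuous_on X \<psi> \<and>
     (\<forall>x\<in>X. \<phi> x = ctrans' X c \<psi> x) \<and>
     (\<forall>x\<in>X. 0 \<le> \<phi> x \<and> \<phi> x \<le> sup_norm_on X c) \<and>
     (\<forall>y\<in>X. - sup_norm_on X c \<le> \<psi> y \<and> \<psi> y \<le> 0)"
  unfolding normalized_pairs_def by blast

lemma normalized_pairs_subset_dual_pairs: "normalized_pairs X c \<subseteq> dual_pairs X c"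
proof
  fix p assume p: "p \<in> normalized_pairs X c"
  obtain \<phi> \<psi> where [simp]: "p = (\<phi>, \<psi>)" by fastforce
  have \<phi>: "continuous_on X \<phi>" "continuous_on X \<psi>" and \<psi>: "\<psi> = ctrans X c \<phi>"
    using p by (auto simp: normalized_pairs_iff)
  have "\<phi> x + \<psi> y \<le> c x y" if "x \<in> X" "y \<in> X" for x y
    using ctrans_le[OF subset_refl bdd_above_continuous[OF \<phi>(1)] that] by (simp add: \<psi>)
  then show "p \<in> dual_pairs X c"
    using \<phi> by (simp add: dual_pairs_def)
qed

end

section \<open>Normalization and compactness of dual pairs\<close>

context compact_cost
begin

text \<open>Replacing \<open>\<phi>\<close> by \<open>\<psi>\<^sup>c\<close> and then \<open>\<psi>\<close> by \<open>\<psi>\<^sup>c\<^sup>c\<close> only increases both functions, and adding a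
  constant to one while subtracting it from the other does not change the value, because both
  measures have mass one. The constant is chosen so that the second function has maximum \<open>0\<close>;
  together with \<open>0 \<le> c\<close> this forces all the bounds of a normalized pair.\<close>

lemma dual_pair_improve:
  assumes q: "q \<in> dual_pairs X c" and \<mu>: "\<mu> \<in> borel_prob X" and \<nu>: "\<nu> \<in> borel_prob X"
  obtains p where "p \<in> normalized_pairs X c" "dual_value \<mu> \<nu> q \<le> dual_value \<mu> \<nu> p"
proof -
  obtain \<phi> \<psi> where [simp]: "q = (\<phi>, \<psi>)" by fastforce
  have \<phi>: "continuous_on X \<phi>" "continuous_on X \<psi>"
    and le: "\<And>x y. x \<in> X \<Longrightarrow> y \<in> X \<Longrightarrow> \<phi> x + \<psi> y \<le> c x y"
    using q by (auto simp: dual_pairs_def)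
  note bdd = bdd_above_continuous
  define \<phi>1 where "\<phi>1 = ctrans' X c \<psi>"
  define \<psi>1 where "\<psi>1 = ctrans X c \<phi>1"
  have c\<phi>1: "continuous_on X \<phi>1"
    unfolding \<phi>1_def by (intro continuous_on_ctrans' bdd \<phi> nonempty subset_refl)
  have c\<psi>1: "continuous_on X \<psi>1"
    unfolding \<psi>1_def by (intro continuous_on_ctrans bdd c\<phi>1 nonempty subset_refl)
  have \<phi>1: "\<phi> x \<le> \<phi>1 x" if "x \<in> X" for x
    unfolding \<phi>1_def using le that by (intro ctrans'_greatest nonempty) (auto simp: le_diff_eq)
  have \<phi>1_le: "\<phi>1 x \<le> c x y - \<psi> y" if "x \<in> X" "y \<in> X" for x y
    unfolding \<phi>1_def using that by (intro ctrans'_le bdd \<phi> subset_refl)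
  have \<psi>1: "\<psi> y \<le> \<psi>1 y" if "y \<in> X" for y
    unfolding \<psi>1_def using \<phi>1_le that by (intro ctrans_greatest nonempty) (auto simp: le_diff_eq algebra_simps)
  have \<psi>1_le: "\<psi>1 y \<le> c x y - \<phi>1 x" if "x \<in> X" "y \<in> X" for x y
    unfolding \<psi>1_def using that by (intro ctrans_le bdd c\<phi>1 subset_refl)
  obtain y0 where y0: "y0 \<in> X" "\<And>y. y \<in> X \<Longrightarrow> \<psi>1 y \<le> \<psi>1 y0"
    using continuous_attains_sup[OF compact_space nonempty c\<psi>1] by blast
  define a where "a = \<psi>1 y0"
  define \<phi>2 where "\<phi>2 = (\<lambda>x. \<phi>1 x + a)"
  define \<psi>2 where "\<psi>2 = ctrans X c \<phi>2"
  have c\<phi>2: "continuous_on X \<phi>2" unfolding \<phi>2_def by (intro continuous_intros c\<phi>1)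
  have c\<psi>2: "continuous_on X \<psi>2"
    unfolding \<psi>2_def by (intro continuous_on_ctrans bdd c\<phi>2 nonempty subset_refl)
  have \<psi>2_le: "\<psi>2 y \<le> c x y - \<phi>2 x" if "x \<in> X" "y \<in> X" for x y
    unfolding \<psi>2_def using that by (intro ctrans_le bdd c\<phi>2 subset_refl)
  have \<psi>2: "\<psi>2 y = \<psi>1 y - a" if "y \<in> X" for y
  proof (rule antisym)
    have "\<psi>2 y + a \<le> \<psi>1 y"
      unfolding \<psi>1_def using \<psi>2_le[OF _ that] by (intro ctrans_greatest nonempty) (auto simp: \<phi>2_def algebra_simps)
    then show "\<psi>2 y \<le> \<psi>1 y - a" by simp
    show "\<psi>1 y - a \<le> \<psi>2 y"
      unfolding \<psi>2_def using \<psi>1_le[OF _ that] by (intro ctrans_greatest nonempty) (auto simp: \<phi>2_def algebra_simps)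
  qed
  have cfix: "\<phi>2 x = ctrans' X c \<psi>2 x" if "x \<in> X" for x
  proof (rule antisym)
    show "\<phi>2 x \<le> ctrans' X c \<psi>2 x"
      using \<psi>2_le[OF that] by (intro ctrans'_greatest nonempty) (auto simp: algebra_simps)
    have "ctrans' X c \<psi>2 x - a \<le> \<phi>1 x"
      unfolding \<phi>1_def
    proof (intro ctrans'_greatest nonempty)
      fix y assume "y \<in> X"
      then show "ctrans' X c \<psi>2 x - a \<le> c x y - \<psi> y"
        using ctrans'_le[OF subset_refl bdd[OF c\<psi>2] \<open>y \<in> X\<close> that] \<psi>2[of y] \<psi>1[of y] by simp
    qed
    then show "ctrans' X c \<psi>2 x \<le> \<phi>2 x" by (simp add: \<phi>2_def)
  qed
  have \<psi>2_nonpos: "\<psi>2 y \<le> 0" if "y \<in> X" for y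
    using \<psi>2 y0 that by (simp add: a_def)
  have \<phi>2_nonneg: "0 \<le> \<phi>2 x" if "x \<in> X" for x
    unfolding cfix[OF that] using \<psi>2_nonpos cost_nonneg that
    by (intro ctrans'_greatest nonempty) force
  have \<phi>2_le: "\<phi>2 x \<le> sup_norm_on X c" if "x \<in> X" for x
    using \<psi>2_le[OF that y0(1)] \<psi>2[OF y0(1)] cost_le_sup_norm[OF that y0(1)] by (simp add: a_def)
  have \<psi>2_ge: "- sup_norm_on X c \<le> \<psi>2 y" if "y \<in> X" for y
    unfolding \<psi>2_def using \<phi>2_le cost_nonneg that by (intro ctrans_greatest nonempty) force
  have "(\<phi>2, \<psi>2) \<in> normalized_pairs X c"
    using c\<phi>2 c\<psi>2 cfix \<psi>2_nonpos \<phi>2_nonneg \<phi>2_le \<psi>2_ge by (auto simp: normalized_pairs_iff \<psi>2_def)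
  moreover have "dual_value \<mu> \<nu> q \<le> dual_value \<mu> \<nu> (\<phi>2, \<psi>2)"
  proof -
    note int = integrable_borel_prob_continuous[OF \<mu> compact_space] integrable_borel_prob_continuous[OF \<nu> compact_space]
    interpret \<mu>: prob_space \<mu> using \<mu> by (rule borel_probD)
    interpret \<nu>: prob_space \<nu> using \<nu> by (rule borel_probD)
    have "(\<integral>x. \<phi> x \<partial>\<mu>) \<le> (\<integral>x. \<phi>2 x - a \<partial>\<mu>)"
      using \<phi>1 borel_probD(2)[OF \<mu>]
      by (intro integral_mono int \<phi> c\<phi>2 continuous_intros) (auto simp: \<phi>2_def)
    also have "\<dots> = (\<integral>x. \<phi>2 x \<partial>\<mu>) - a"
      using int(1)[OF c\<phi>2] by (simp add: \<mu>.prob_space)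
    finally have 1: "(\<integral>x. \<phi> x \<partial>\<mu>) \<le> (\<integral>x. \<phi>2 x \<partial>\<mu>) - a" .
    have "(\<integral>x. \<psi> x \<partial>\<nu>) \<le> (\<integral>x. \<psi>2 x + a \<partial>\<nu>)"
      using \<psi>1 \<psi>2 borel_probD(2)[OF \<nu>]
      by (intro integral_mono int \<phi> c\<psi>2 continuous_intros) auto
    also have "\<dots> = (\<integral>x. \<psi>2 x \<partial>\<nu>) + a"
      using int(2)[OF c\<psi>2] by (simp add: \<nu>.prob_space)
    finally show ?thesis
      using 1 by (simp add: dual_value_def)
  qed
  ultimately show ?thesis using that by blast
qed

text \<open>Being \<open>c\<close>-transforms, the first components are equicontinuous, and they are bounded by
  definition, so Arzela--Ascoli gives a uniform limit of a subsequence. Taking \<open>c\<close>-transforms is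
  nonexpansive for the uniform norm; hence the second components converge as well and the
  limit is again a normalized pair. Pointwise convergence is the form in which dominated
  convergence uses the result.\<close>

lemma normalized_pairs_compact:
  assumes p: "\<And>n :: nat. p n \<in> normalized_pairs X c"
  shows "\<exists>k q. strict_mono k \<and> q \<in> normalized_pairs X c \<and>
    (\<forall>x\<in>X. (\<lambda>n. fst (p (k n)) x) \<longlonglongrightarrow> fst q x) \<and>
    (\<forall>y\<in>X. (\<lambda>n. snd (p (k n)) y) \<longlonglongrightarrow> snd q y)"
proof -
  define \<phi> where "\<phi> = (\<lambda>n. fst (p n))"
  define \<psi> where "\<psi> = (\<lambda>n. snd (p n))"
  have "(\<phi> n, \<psi> n) \<in> normalized_pairs X c" for n
    using p[of n] by (simp add: \<phi>_def \<psi>_def)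
  note normalized = this[unfolded normalized_pairs_iff]
  have \<psi>: "\<And>n. \<psi> n = ctrans X c (\<phi> n)"
    and cont: "\<And>n. continuous_on X (\<phi> n)" "\<And>n. continuous_on X (\<psi> n)"
    and cfix: "\<And>n x. x \<in> X \<Longrightarrow> \<phi> n x = ctrans' X c (\<psi> n) x"
    and \<phi>_bd: "\<And>n x. x \<in> X \<Longrightarrow> 0 \<le> \<phi> n x \<and> \<phi> n x \<le> sup_norm_on X c"
    and \<psi>_bd: "\<And>n x. x \<in> X \<Longrightarrow> - sup_norm_on X c \<le> \<psi> n x \<and> \<psi> n x \<le> 0"
    using normalized by blast+
  note bdd = bdd_above_continuous
  obtain g k where g: "continuous_on X g" and k: "strict_mono (k :: nat \<Rightarrow> nat)"
    and unif: "\<And>e. 0 < e \<Longrightarrow> \<exists>N. \<forall>n x. n \<ge> N \<and> x \<in> X \<longrightarrow> norm (\<phi> (k n) x - g x) < e"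
  proof (rule Arzela_Ascoli[OF compact_space, of \<phi> "sup_norm_on X c"])
    show "norm (\<phi> n x) \<le> sup_norm_on X c" if "x \<in> X" for n x
      using \<phi>_bd[OF that, of n] by simp
    fix x and e :: real assume x: "x \<in> X" and "0 < e"
    obtain d where d: "d > 0"
      "\<forall>S \<phi>. S \<subseteq> X \<longrightarrow> S \<noteq> {} \<longrightarrow> bdd_above (\<phi> ` S) \<longrightarrow>
        (\<forall>y\<in>X. \<forall>y'\<in>X. dist y y' < d \<longrightarrow> \<bar>ctrans' S c \<phi> y - ctrans' S c \<phi> y'\<bar> < e)"
      using ctrans'_equicontinuous[OF \<open>0 < e\<close>] by auto
    have "norm (\<phi> n x - \<phi> n y) < e" if "y \<in> X" "norm (x - y) < d" for n y
      using d(2)[rule_format, OF subset_refl nonempty bdd[OF cont(2)[of n]] x that(1)] that cfix x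
      by (simp add: dist_norm)
    then show "\<exists>d>0. \<forall>n y. y \<in> X \<and> norm (x - y) < d \<longrightarrow> norm (\<phi> n x - \<phi> n y) < e"
      using d(1) by blast
  qed blast
  define h where "h = ctrans X c g"
  have h: "continuous_on X h"
    unfolding h_def by (intro continuous_on_ctrans bdd g nonempty subset_refl)
  have unif': "\<exists>N. \<forall>n y. n \<ge> N \<and> y \<in> X \<longrightarrow> \<bar>\<psi> (k n) y - h y\<bar> \<le> e" if e: "0 < e" for e
  proof -
    obtain N where N: "\<And>n x. n \<ge> N \<Longrightarrow> x \<in> X \<Longrightarrow> norm (\<phi> (k n) x - g x) < e"
      using unif[OF e] by blast
    have "\<bar>\<psi> (k n) y - h y\<bar> \<le> e" if "n \<ge> N" "y \<in> X" for n y
      unfolding \<psi> h_def ctrans_def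
    proof (intro abs_cINF_diff_le nonempty ctrans_bdd_below subset_refl bdd g cont that)
      fix x assume "x \<in> X"
      then show "\<bar>c x y - \<phi> (k n) x - (c x y - g x)\<bar> \<le> e"
        using N[OF that(1), of x] by simp
    qed
    then show ?thesis by blast
  qed
  have lim\<phi>: "(\<lambda>n. \<phi> (k n) x) \<longlonglongrightarrow> g x" if "x \<in> X" for x
    unfolding LIMSEQ_def dist_norm using unif that by blast
  have lim\<psi>: "(\<lambda>n. \<psi> (k n) y) \<longlonglongrightarrow> h y" if "y \<in> X" for y
    unfolding LIMSEQ_def dist_real_def
  proof (intro allI impI)
    fix e :: real assume "0 < e"
    then obtain N where "\<forall>n y. n \<ge> N \<and> y \<in> X \<longrightarrow> \<bar>\<psi> (k n) y - h y\<bar> \<le> e / 2"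
      using unif'[of "e / 2"] by auto
    then show "\<exists>N. \<forall>n\<ge>N. \<bar>\<psi> (k n) y - h y\<bar> < e"
      using that \<open>0 < e\<close> by (intro exI[of _ N]) force
  qed
  have g_bd: "0 \<le> g x \<and> g x \<le> sup_norm_on X c" if "x \<in> X" for x
    using LIMSEQ_le_const[OF lim\<phi>[OF that], of 0] LIMSEQ_le_const2[OF lim\<phi>[OF that]] \<phi>_bd[OF that] by blast
  have h_bd: "- sup_norm_on X c \<le> h x \<and> h x \<le> 0" if "x \<in> X" for x
    using LIMSEQ_le_const[OF lim\<psi>[OF that]] LIMSEQ_le_const2[OF lim\<psi>[OF that], of 0] \<psi>_bd[OF that] by blast
  have g_fix: "g x = ctrans' X c h x" if x: "x \<in> X" for x
  proof (rule antisym)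
    show "g x \<le> ctrans' X c h x"
    proof (intro ctrans'_greatest nonempty)
      fix y assume "y \<in> X"
      then show "g x \<le> c x y - h y"
        using ctrans_le[OF subset_refl bdd[OF g] x] by (simp add: h_def le_diff_eq algebra_simps)
    qed
    show "ctrans' X c h x \<le> g x"
    proof (rule field_le_epsilon)
      fix e :: real assume "0 < e"
      then obtain N where N: "\<forall>n y. n \<ge> N \<and> y \<in> X \<longrightarrow> \<bar>\<psi> (k n) y - h y\<bar> \<le> e"
        using unif' by blast
      have "ctrans' X c h x - e \<le> \<phi> (k n) x" if "n \<ge> N" for n
        unfolding cfix[OF x]
      proof (intro ctrans'_greatest nonempty)
        fix y assume y: "y \<in> X"
        then show "ctrans' X c h x - e \<le> c x y - \<psi> (k n) y"
          using ctrans'_le[OF subset_refl bdd[OF h] y x] N[rule_format, of n y] that by auto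
      qed
      then have "ctrans' X c h x - e \<le> g x"
        by (intro LIMSEQ_le_const[OF lim\<phi>[OF x]]) blast
      then show "ctrans' X c h x \<le> g x + e" by simp
    qed
  qed
  have "(g, h) \<in> normalized_pairs X c"
    using g h g_bd h_bd g_fix by (auto simp: normalized_pairs_iff h_def)
  then show ?thesis
    using k lim\<phi> lim\<psi> unfolding \<phi>_def \<psi>_def by (intro exI[of _ k] exI[of _ "(g, h)"]) simp
qed

lemma dual_value_tendsto:
  assumes \<mu>: "\<mu> \<in> borel_prob X" and \<nu>: "\<nu> \<in> borel_prob X"
    and p: "\<And>n. p n \<in> normalized_pairs X c" and q: "q \<in> normalized_pairs X c"
    and lim: "\<And>x. x \<in> X \<Longrightarrow> (\<lambda>n. fst (p n) x) \<longlonglongrightarrow> fst q x"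
      "\<And>y. y \<in> X \<Longrightarrow> (\<lambda>n. snd (p n) y) \<longlonglongrightarrow> snd q y"
  shows "(\<lambda>n. dual_value \<mu> \<nu> (p n)) \<longlonglongrightarrow> dual_value \<mu> \<nu> q"
proof -
  have props: "continuous_on X (fst r)" "continuous_on X (snd r)"
     "x \<in> X \<Longrightarrow> \<bar>fst r x\<bar> \<le> sup_norm_on X c" "x \<in> X \<Longrightarrow> \<bar>snd r x\<bar> \<le> sup_norm_on X c"
    if "r \<in> normalized_pairs X c" for r x
    using that by (cases r; force simp: normalized_pairs_iff)+
  show ?thesis
    unfolding dual_value_def case_prod_unfold
    by (intro tendsto_add integral_borel_prob_tendsto[OF \<mu>, where B = "sup_norm_on X c"]
        integral_borel_prob_tendsto[OF \<nu>, where B = "sup_norm_on X c"] props p q lim)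
qed

text \<open>A maximizing sequence may be taken in the compact set of normalized pairs.\<close>

lemma normalized_potentials_nonempty:
  assumes \<mu>: "\<mu> \<in> borel_prob X" and \<nu>: "\<nu> \<in> borel_prob X"
    and bdd: "bdd_above (dual_value \<mu> \<nu> ` dual_pairs X c)"
  obtains p where "p \<in> normalized_potentials X c \<mu> \<nu>"
proof -
  define M where "M = (SUP q\<in>dual_pairs X c. dual_value \<mu> \<nu> q)"
  have "(\<lambda>_. 0, \<lambda>_. 0) \<in> dual_pairs X c"
    using cost_nonneg by (simp add: dual_pairs_def)
  then have ne: "dual_pairs X c \<noteq> {}" by blast
  have "\<exists>p. p \<in> normalized_pairs X c \<and> M - inverse (real (Suc n)) < dual_value \<mu> \<nu> p" for n
  proof -
    have "M - inverse (real (Suc n)) < M" by simp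
    then obtain q where q: "q \<in> dual_pairs X c" "M - inverse (real (Suc n)) < dual_value \<mu> \<nu> q"
      unfolding M_def less_cSUP_iff[OF ne bdd] by blast
    then show ?thesis
      using dual_pair_improve[OF q(1) \<mu> \<nu>] by (metis order_less_le_trans)
  qed
  then obtain p where p: "\<And>n. p n \<in> normalized_pairs X c"
      "\<And>n. M - inverse (real (Suc n)) < dual_value \<mu> \<nu> (p n)"
    by metis
  obtain k q where k: "strict_mono k" and q: "q \<in> normalized_pairs X c"
    and lim: "\<forall>x\<in>X. (\<lambda>n. fst (p (k n)) x) \<longlonglongrightarrow> fst q x"
     "\<forall>y\<in>X. (\<lambda>n. snd (p (k n)) y) \<longlonglongrightarrow> snd q y"
    using normalized_pairs_compact[of p, OF p(1)] by auto
  have 1: "(\<lambda>n. dual_value \<mu> \<nu> (p (k n))) \<longlonglongrightarrow> dual_value \<mu> \<nu> q"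
    by (rule dual_value_tendsto[OF \<mu> \<nu> p(1) q lim[rule_format]])
  have 2: "(\<lambda>n. M - inverse (real (Suc (k n)))) \<longlonglongrightarrow> M - 0"
    using LIMSEQ_subseq_LIMSEQ[OF LIMSEQ_inverse_real_of_nat k]
    by (intro tendsto_intros) (simp add: o_def)
  have "M - 0 \<le> dual_value \<mu> \<nu> q"
    by (rule LIMSEQ_le[OF 2 1]) (use p(2) in \<open>auto intro: less_imp_le\<close>)
  then have "dual_value \<mu> \<nu> r \<le> dual_value \<mu> \<nu> q" if "r \<in> dual_pairs X c" for r
    using cSUP_upper[OF that bdd] by (simp add: M_def)
  then have "q \<in> normalized_potentials X c \<mu> \<nu>"
    using q normalized_pairs_subset_dual_pairs
    by (auto simp: normalized_potentials_def kantorovich_potentials_def)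
  then show ?thesis by (rule that)
qed

end

section \<open>Linear programming duality for discrete transport\<close>

text \<open>Linearity over the pointwise operations, condensed into the one combination that occurs when
  a vector is projected along another; homogeneity and additivity follow from it.\<close>

definition linear_functional :: "(('k \<Rightarrow> real) \<Rightarrow> real) \<Rightarrow> bool" where
  "linear_functional f \<longleftrightarrow> (\<forall>x y s. f (\<lambda>k. x k - s * y k) = f x - s * f y)"

lemma linear_functional_zero: "linear_functional f \<Longrightarrow> f (\<lambda>k. 0) = 0"
  unfolding linear_functional_def by (drule spec2[of _ "\<lambda>k. 0" "\<lambda>k. 0"], drule spec[of _ 1]) simp

lemma linear_functional_scale:
  assumes "linear_functional f" shows "f (\<lambda>k. s * y k) = s * f y"
proof -
  have "f (\<lambda>k. 0 - (- s) * y k) = f (\<lambda>k. 0) - (- s) * f y"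
    by (rule assms[unfolded linear_functional_def, rule_format, of "\<lambda>k. 0" "- s" y])
  then show ?thesis
    using linear_functional_zero[OF assms] by simp
qed

text \<open>Bartl's induction on the number of functionals. If \<open>g\<close> is not already controlled by the others,
  some \<open>x'\<close> violates the conclusion while satisfying the constraints in \<open>I\<close>, hence \<open>F j x' > 0\<close>.
  Projecting along \<open>x'\<close> onto the kernel of \<open>F j\<close> removes the constraint \<open>j\<close>, the induction
  hypothesis applies to the projected functionals, and the coefficient of \<open>F j\<close> is read off from the
  values at \<open>x'\<close>.\<close>

lemma farkas:
  fixes F :: "'i \<Rightarrow> ('k \<Rightarrow> real) \<Rightarrow> real" and g :: "('k \<Rightarrow> real) \<Rightarrow> real"
  assumes "finite I"
    and "\<And>i. i \<in> I \<Longrightarrow> linear_functional (F i)" "linear_functional g"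
    and "\<And>x. (\<And>i. i \<in> I \<Longrightarrow> F i x \<le> 0) \<Longrightarrow> g x \<le> 0"
  shows "\<exists>l. (\<forall>i\<in>I. 0 \<le> l i) \<and> (\<forall>x. g x = (\<Sum>i\<in>I. l i * F i x))"
  using assms
proof (induction I arbitrary: F g rule: finite_induct)
  case empty
  have "g x = 0" for x
    using empty(3)[of x] empty(3)[of "\<lambda>k. (-1) * x k"] linear_functional_scale[OF empty(2), of "-1" x]
    by simp
  then show ?case by simp
next
  case (insert j I)
  show ?case
  proof (cases "\<forall>x. (\<forall>i\<in>I. F i x \<le> 0) \<longrightarrow> g x \<le> 0")
    case True
    then obtain l where l: "\<forall>i\<in>I. 0 \<le> l i" "\<forall>x. g x = (\<Sum>i\<in>I. l i * F i x)"
      using insert.IH[of F g] insert.prems by auto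
    have "(\<Sum>i\<in>insert j I. (l(j := 0)) i * F i x) = (\<Sum>i\<in>I. l i * F i x)" for x
      using insert.hyps by (simp, intro sum.cong) auto
    then show ?thesis
      using l by (intro exI[of _ "l(j := 0)"]) auto
  next
    case False
    then obtain x' where x': "\<forall>i\<in>I. F i x' \<le> 0" "g x' > 0"
      by (auto simp: not_le)
    have lin: "F i (\<lambda>k. x k - s * y k) = F i x - s * F i y" if "i \<in> insert j I" for i x s y
      using insert.prems(1)[OF that] by (simp add: linear_functional_def)
    have ling: "g (\<lambda>k. x k - s * y k) = g x - s * g y" for x s y
      using insert.prems(2) by (simp add: linear_functional_def)
    define s where "s = F j x'"
    have s: "s > 0"
      using insert.prems(3)[of x'] x' by (force simp: s_def)
    define F' where "F' = (\<lambda>i x. F i x - F j x / s * F i x')"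
    define g' where "g' = (\<lambda>x. g x - F j x / s * g x')"
    have "\<exists>l. (\<forall>i\<in>I. 0 \<le> l i) \<and> (\<forall>x. g' x = (\<Sum>i\<in>I. l i * F' i x))"
    proof (rule insert.IH)
      show "linear_functional (F' i)" if "i \<in> I" for i
        using that by (simp add: linear_functional_def F'_def lin) (simp add: algebra_simps diff_divide_distrib)
      show "linear_functional g'"
        by (simp add: linear_functional_def g'_def lin ling) (simp add: algebra_simps diff_divide_distrib)
      fix x assume x: "\<And>i. i \<in> I \<Longrightarrow> F' i x \<le> 0"
      have "g (\<lambda>k. x k - F j x / s * x' k) \<le> 0"
      proof (rule insert.prems(3))
        fix i assume "i \<in> insert j I"
        then show "F i (\<lambda>k. x k - F j x / s * x' k) \<le> 0"
          using x[of i] s lin[of i x "F j x / s" x'] by (auto simp: F'_def s_def)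
      qed
      then show "g' x \<le> 0"
        by (simp only: g'_def ling)
    qed
    then obtain l where l: "\<forall>i\<in>I. 0 \<le> l i" and eq: "\<And>x. g' x = (\<Sum>i\<in>I. l i * F' i x)"
      by blast
    define lj where "lj = (g x' - (\<Sum>i\<in>I. l i * F i x')) / s"
    have "(\<Sum>i\<in>I. l i * F i x') \<le> 0"
      using l x' by (intro sum_nonpos mult_nonneg_nonpos) auto
    then have lj: "0 \<le> lj"
      using x' s by (simp add: lj_def)
    have "g x = (\<Sum>i\<in>insert j I. (l(j := lj)) i * F i x)" for x
    proof -
      have "g x = (\<Sum>i\<in>I. l i * F' i x) + F j x / s * g x'"
        using eq[of x] by (simp add: g'_def)
      also have "(\<Sum>i\<in>I. l i * F' i x) = (\<Sum>i\<in>I. l i * F i x) - F j x / s * (\<Sum>i\<in>I. l i * F i x')"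
        by (simp add: F'_def sum_distrib_left sum_subtractf right_diff_distrib mult.left_commute)
      also have "\<dots> + F j x / s * g x' = lj * F j x + (\<Sum>i\<in>I. l i * F i x)"
        using s by (simp add: lj_def field_simps)
      also have "\<dots> = (\<Sum>i\<in>insert j I. (l(j := lj)) i * F i x)"
        using insert.hyps by (simp, intro sum.cong) auto
      finally show ?thesis .
    qed
    then show ?thesis
      using l lj by (intro exI[of _ "l(j := lj)"]) auto
  qed
qed

text \<open>The Farkas lemma is applied to the homogenized dual problem, whose variables are \<open>u\<close>, \<open>v\<close> and a
  scaling factor \<open>t \<ge> 0\<close>, with constraints \<open>u i + v j \<le> t C i j\<close>. The multipliers of these
  constraints form the plan \<open>w\<close>: comparing the coefficients of \<open>u i\<close>, \<open>v j\<close> and \<open>t\<close> gives the two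
  marginals and the bound on the cost.\<close>

lemma discrete_transport_duality:
  fixes K :: "'k set" and a b :: "'k \<Rightarrow> real"
  assumes K: "finite K"
    and a: "\<And>i. i \<in> K \<Longrightarrow> 0 \<le> a i" "sum a K = 1"
    and b: "\<And>i. i \<in> K \<Longrightarrow> 0 \<le> b i" "sum b K = 1"
    and bound: "\<And>u v. (\<And>i j. i \<in> K \<Longrightarrow> j \<in> K \<Longrightarrow> u i + v j \<le> C i j) \<Longrightarrow>
        (\<Sum>i\<in>K. a i * u i) + (\<Sum>j\<in>K. b j * v j) \<le> M"
  obtains w where "\<And>i j. i \<in> K \<Longrightarrow> j \<in> K \<Longrightarrow> 0 \<le> w i j"
    "\<And>i. i \<in> K \<Longrightarrow> (\<Sum>j\<in>K. w i j) = a i" "\<And>j. j \<in> K \<Longrightarrow> (\<Sum>i\<in>K. w i j) = b j"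
    "(\<Sum>i\<in>K. \<Sum>j\<in>K. w i j * C i j) \<le> M"
proof -
  define F :: "('k \<times> 'k) option \<Rightarrow> (('k + 'k) option \<Rightarrow> real) \<Rightarrow> real" where
    "F = (\<lambda>p x. case p of None \<Rightarrow> - x None
       | Some (i, j) \<Rightarrow> x (Some (Inl i)) + x (Some (Inr j)) - x None * C i j)"
  define g :: "(('k + 'k) option \<Rightarrow> real) \<Rightarrow> real" where
    "g = (\<lambda>x. (\<Sum>i\<in>K. a i * x (Some (Inl i))) + (\<Sum>j\<in>K. b j * x (Some (Inr j))) - x None * M)"
  define I where "I = insert None (Some ` (K \<times> K))"
  have "\<exists>l. (\<forall>p\<in>I. 0 \<le> l p) \<and> (\<forall>x. g x = (\<Sum>p\<in>I. l p * F p x))"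
  proof (rule farkas)
    show "finite I" using K by (simp add: I_def)
    show "linear_functional (F p)" for p
      by (auto simp: linear_functional_def F_def algebra_simps split: option.split)
    show "linear_functional g"
      by (simp add: linear_functional_def g_def algebra_simps sum_subtractf sum_distrib_left)
    fix x assume x: "\<And>p. p \<in> I \<Longrightarrow> F p x \<le> 0"
    define t where "t = x None"
    define u where "u = (\<lambda>i. x (Some (Inl i)))"
    define v where "v = (\<lambda>j. x (Some (Inr j)))"
    have t: "0 \<le> t"
      using x[of None] by (simp add: I_def F_def t_def)
    have uv: "u i + v j \<le> t * C i j" if "i \<in> K" "j \<in> K" for i j
      using x[of "Some (i, j)"] that by (simp add: I_def F_def t_def u_def v_def)
    have g: "g x = (\<Sum>i\<in>K. a i * u i) + (\<Sum>j\<in>K. b j * v j) - t * M"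
      by (simp add: g_def u_def v_def t_def)
    show "g x \<le> 0"
    proof (cases "t = 0")
      case True
      have "(\<Sum>i\<in>K. a i * u i) + (\<Sum>j\<in>K. b j * v j)
          = (\<Sum>i\<in>K. a i * u i) * sum b K + sum a K * (\<Sum>j\<in>K. b j * v j)"
        by (simp add: a b)
      also have "\<dots> = (\<Sum>i\<in>K. \<Sum>j\<in>K. a i * b j * (u i + v j))"
        by (simp only: sum_product sum.distrib[symmetric]) (simp add: algebra_simps)
      also have "\<dots> \<le> 0"
        using uv True by (intro sum_nonpos mult_nonneg_nonpos mult_nonneg_nonneg a b) auto
      finally show ?thesis using True g by simp
    next
      case False
      with t have t: "t > 0" by simp
      have "(\<Sum>i\<in>K. a i * (u i / t)) + (\<Sum>j\<in>K. b j * (v j / t)) \<le> M"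
        using uv t by (intro bound) (simp add: field_simps)
      then show ?thesis
        using t by (simp add: g sum_divide_distrib[symmetric] field_simps)
    qed
  qed
  then obtain l where l: "\<And>p. p \<in> I \<Longrightarrow> 0 \<le> l p" and gl: "\<And>x. g x = (\<Sum>p\<in>I. l p * F p x)"
    by blast
  define w where "w = (\<lambda>i j. l (Some (i, j)))"
  have rep: "g x = - l None * x None
      + (\<Sum>i\<in>K. \<Sum>j\<in>K. w i j * (x (Some (Inl i)) + x (Some (Inr j)) - x None * C i j))" for x
    unfolding gl I_def using K
    by (subst sum.insert) (auto simp: sum.reindex F_def w_def sum.cartesian_product case_prod_unfold)
  \<comment> \<open>the same representation with the sums exchanged, so that a unit vector can be inserted on either side\<close>
  have rep': "g x = - l None * x None
      + (\<Sum>j\<in>K. \<Sum>i\<in>K. w i j * (x (Some (Inl i)) + x (Some (Inr j)) - x None * C i j))" for x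
    unfolding rep by (subst sum.swap) (rule refl)
  show ?thesis
  proof (rule that[of w])
    show "0 \<le> w i j" if "i \<in> K" "j \<in> K" for i j
      using l that by (simp add: w_def I_def)
    show "(\<Sum>j\<in>K. w i j) = a i" if "i \<in> K" for i
      using rep'[of "\<lambda>k. if k = Some (Inl i) then 1 else 0"] that K
      by (simp add: g_def sum.delta if_distrib[of "\<lambda>z. _ * z"] cong: if_cong)
    show "(\<Sum>i\<in>K. w i j) = b j" if "j \<in> K" for j
      using rep[of "\<lambda>k. if k = Some (Inr j) then 1 else 0"] that K
      by (simp add: g_def sum.delta if_distrib[of "\<lambda>z. _ * z"] cong: if_cong)
    show "(\<Sum>i\<in>K. \<Sum>j\<in>K. w i j * C i j) \<le> M"
      using rep[of "\<lambda>k. if k = None then 1 else 0"] l[of None]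
      by (simp add: g_def sum_negf I_def)
  qed
qed

section \<open>Kantorovich duality by discretization\<close>

text \<open>Adding a point to the net redirects the points of its ball to it. Measurability of the level
  sets suffices, as the rounding map takes finitely many values on \<open>X\<close>.\<close>

lemma finite_rounding_aux:
  fixes F :: "'a::metric_space set"
  assumes "finite F"
  shows "\<exists>r :: 'a \<Rightarrow> 'a. (\<forall>i. {x. r x = i} \<in> sets borel) \<and> (\<forall>x\<in>(\<Union>p\<in>F. ball p d). r x \<in> F \<and> dist x (r x) < d)"
  using assms
proof induction
  case empty
  have "{x :: 'a. undefined = i} \<in> sets borel" for i :: 'a
    by (cases "undefined = i") auto
  then show ?case by (intro exI[of _ "\<lambda>_. undefined"]) auto
next
  case (insert p F)
  then obtain r :: "'a \<Rightarrow> 'a" where r: "\<And>i. {x. r x = i} \<in> sets borel"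
    "\<And>x. x \<in> (\<Union>p\<in>F. ball p d) \<Longrightarrow> r x \<in> F \<and> dist x (r x) < d"
    by blast
  define r' where "r' = (\<lambda>x. if x \<in> ball p d then p else r x)"
  have "{x. r' x = i} = ({x. r x = i} - ball p d) \<union> (if i = p then ball p d else {})" for i
    by (auto simp: r'_def)
  then have "{x. r' x = i} \<in> sets borel" for i
    using r(1)[of i] by auto
  moreover have "r' x \<in> insert p F \<and> dist x (r' x) < d" if "x \<in> (\<Union>p\<in>insert p F. ball p d)" for x
    using r(2)[of x] that by (auto simp: r'_def dist_commute)
  ultimately show ?case by (intro exI[of _ r']) blast
qed

lemma finite_rounding:
  fixes X :: "'a::metric_space set"
  assumes "compact X" "0 < d"
  obtains F and r :: "'a \<Rightarrow> 'a" where "finite F" "F \<subseteq> X" "\<And>i. {x. r x = i} \<in> sets borel"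
    "\<And>x. x \<in> X \<Longrightarrow> r x \<in> F" "\<And>x. x \<in> X \<Longrightarrow> dist x (r x) < d"
proof -
  have "X \<subseteq> (\<Union>p\<in>X. ball p d)" using \<open>0 < d\<close> by auto
  then obtain F where F: "F \<subseteq> X" "finite F" "X \<subseteq> (\<Union>p\<in>F. ball p d)"
    using compactE_image[OF \<open>compact X\<close>, of X "\<lambda>p. ball p d"] by auto
  obtain r :: "'a \<Rightarrow> 'a" where "\<forall>i. {x. r x = i} \<in> sets borel"
      "\<forall>x\<in>(\<Union>p\<in>F. ball p d). r x \<in> F \<and> dist x (r x) < d"
    using finite_rounding_aux[OF F(2)] by blast
  then show ?thesis
    using F by (intro that[of F r]) auto
qed

text \<open>Level sets are used instead of measurability into a discrete space, because a product of discrete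
  spaces is in general not discrete as a measurable space, and the lemma is applied both to the
  rounding map and to its product with itself.\<close>

lemma finite_range_integral:
  fixes g :: "'b \<Rightarrow> real"
  assumes M: "finite_measure M" and F: "finite F" "\<And>x. x \<in> space M \<Longrightarrow> r x \<in> F"
    and r: "\<And>i. i \<in> F \<Longrightarrow> {x \<in> space M. r x = i} \<in> sets M"
  shows finite_range_measurable: "(\<lambda>x. g (r x)) \<in> borel_measurable M"
    and finite_range_integrable: "integrable M (\<lambda>x. g (r x))"
    and finite_range_integral_eq: "(\<integral>x. g (r x) \<partial>M) = (\<Sum>i\<in>F. measure M {x \<in> space M. r x = i} * g i)"
proof -
  interpret finite_measure M by fact
  have eq: "g (r x) = (\<Sum>i\<in>F. indicator {x \<in> space M. r x = i} x * g i)" if "x \<in> space M" for x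
    using F that by (simp add: indicator_def sum.delta if_distrib[of "\<lambda>z. z * _"] cong: if_cong)
  have int: "integrable M (\<lambda>x. indicator {x \<in> space M. r x = i} x * g i)" if "i \<in> F" for i
    using r[OF that] by (intro integrable_mult_left integrable_real_indicator) (auto simp: emeasure_eq_measure)
  show int': "integrable M (\<lambda>x. g (r x))"
    using int by (subst Bochner_Integration.integrable_cong[OF refl eq]) auto
  then show "(\<lambda>x. g (r x)) \<in> borel_measurable M" by simp
  have "(\<integral>x. g (r x) \<partial>M) = (\<integral>x. (\<Sum>i\<in>F. indicator {x \<in> space M. r x = i} x * g i) \<partial>M)"
    by (intro Bochner_Integration.integral_cong eq) auto
  also have "\<dots> = (\<Sum>i\<in>F. \<integral>x. indicator {x \<in> space M. r x = i} x * g i \<partial>M)"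
    using int by (rule Bochner_Integration.integral_sum)
  also have "\<dots> = (\<Sum>i\<in>F. measure M {x \<in> space M. r x = i} * g i)"
    using r by (intro sum.cong) (auto intro!: sets.Int_space_eq2 arg_cong[of _ _ "measure M"])
  finally show "(\<integral>x. g (r x) \<partial>M) = (\<Sum>i\<in>F. measure M {x \<in> space M. r x = i} * g i)" .
qed

text \<open>The density with respect to \<open>\<mu> \<times> \<nu>\<close> obtained by spreading a discrete plan \<open>w\<close> proportionally over
  the cells of the rounding map has first marginal \<open>\<mu>\<close>. Cells of mass zero cause division by zero,
  but \<open>w\<close> vanishes on those of \<open>\<nu>\<close>, and those of \<open>\<mu>\<close> are excluded almost everywhere.\<close>

lemma step_plan_row_mass:
  fixes r :: "'a::topological_space \<Rightarrow> 'a" and \<mu> \<nu> :: "'a measure"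
  defines "a \<equiv> \<lambda>i. measure \<mu> {x \<in> space \<mu>. r x = i}"
    and "b \<equiv> \<lambda>i. measure \<nu> {x \<in> space \<nu>. r x = i}"
  assumes \<mu>: "finite_measure \<mu>" and \<nu>: "finite_measure \<nu>"
    and F: "finite F" "\<And>x. x \<in> space \<mu> \<Longrightarrow> r x \<in> F" "\<And>x. x \<in> space \<nu> \<Longrightarrow> r x \<in> F"
    and r: "\<And>i. {x \<in> space \<mu>. r x = i} \<in> sets \<mu>" "\<And>i. {x \<in> space \<nu>. r x = i} \<in> sets \<nu>"
    and w: "\<And>i j. i \<in> F \<Longrightarrow> j \<in> F \<Longrightarrow> 0 \<le> w i j"
    "\<And>i. i \<in> F \<Longrightarrow> (\<Sum>j\<in>F. w i j) = a i" "\<And>j. j \<in> F \<Longrightarrow> (\<Sum>i\<in>F. w i j) = b j"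
  shows "AE x in \<mu>. (\<integral>\<^sup>+y. ennreal (w (r x) (r y) / (a (r x) * b (r y))) \<partial>\<nu>) = 1"
proof -
  interpret \<mu>: finite_measure \<mu> by fact
  have a_nonneg: "0 \<le> a i" and b_nonneg: "0 \<le> b i" for i
    by (simp_all add: a_def b_def)
  have "AE x in \<mu>. \<forall>i\<in>F. a i = 0 \<longrightarrow> r x \<noteq> i"
  proof (intro AE_finite_allI F(1))
    fix i assume "i \<in> F"
    show "AE x in \<mu>. a i = 0 \<longrightarrow> r x \<noteq> i"
    proof (cases "a i = 0")
      case True
      then have "{x \<in> space \<mu>. r x = i} \<in> null_sets \<mu>"
        using r(1)[of i] by (auto simp: a_def null_sets_def \<mu>.emeasure_eq_measure)
      then show ?thesis
        by (rule AE_I'[where N = "{x \<in> space \<mu>. r x = i}"]) auto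
    qed simp
  qed
  then show ?thesis
  proof (rule AE_mp, intro AE_I2 impI)
    fix x assume x: "x \<in> space \<mu>" "\<forall>i\<in>F. a i = 0 \<longrightarrow> r x \<noteq> i"
    let ?i = "r x"
    have i: "?i \<in> F" "a ?i \<noteq> 0"
      using x F(2) by blast+
    note fr = finite_range_integral[OF \<nu> F(1,3) r(2), where g = "\<lambda>j. w ?i j / (a ?i * b j)"]
    have "(\<integral>\<^sup>+y. ennreal (w ?i (r y) / (a ?i * b (r y))) \<partial>\<nu>)
        = ennreal (\<integral>y. w ?i (r y) / (a ?i * b (r y)) \<partial>\<nu>)"
      using fr(2) w(1)[OF i(1)] F(3) a_nonneg b_nonneg
      by (intro nn_integral_eq_integral AE_I2) (auto intro!: divide_nonneg_nonneg mult_nonneg_nonneg)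
    also have "(\<integral>y. w ?i (r y) / (a ?i * b (r y)) \<partial>\<nu>) = (\<Sum>j\<in>F. b j * (w ?i j / (a ?i * b j)))"
      using fr(3) by (simp add: b_def)
    also have "\<dots> = (\<Sum>j\<in>F. w ?i j / a ?i)"
    proof (intro sum.cong refl)
      fix j assume j: "j \<in> F"
      have "w ?i j = 0" if "b j = 0"
        using w(3)[OF j] that F(1) i(1) j w(1) by (auto simp: sum_nonneg_eq_0_iff)
      then show "b j * (w ?i j / (a ?i * b j)) = w ?i j / a ?i"
        by (cases "b j = 0") auto
    qed
    also have "\<dots> = 1"
      using w(2)[OF i(1)] i(2) by (simp add: sum_divide_distrib[symmetric])
    finally show "(\<integral>\<^sup>+y. ennreal (w ?i (r y) / (a ?i * b (r y))) \<partial>\<nu>) = 1"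
      by simp
  qed
qed

lemma
  fixes X Y :: "'a::second_countable_topology set"
  shows measurable_fst_restrict: "fst \<in> restrict_space borel (X \<times> Y) \<rightarrow>\<^sub>M restrict_space borel X"
    and measurable_snd_restrict: "snd \<in> restrict_space borel (X \<times> Y) \<rightarrow>\<^sub>M restrict_space borel Y"
  by (rule measurable_restrict_space2,
      force simp: space_restrict_space,
      intro measurable_restrict_space1 borel_measurable_continuous_onI continuous_intros)+

text \<open>The measure is transported by the identity because the product \<open>\<sigma>\<close>-algebra of \<open>\<mu>\<close> and \<open>\<nu>\<close> has to be
  replaced by the Borel \<open>\<sigma>\<close>-algebra of \<open>X \<times> X\<close>, which is the one that couplings carry.\<close>

lemma coupling_from_density:
  fixes \<mu> \<nu> :: "'a::second_countable_topology measure"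
  assumes \<mu>: "\<mu> \<in> borel_prob X" and \<nu>: "\<nu> \<in> borel_prob X"
    and h[measurable]: "h \<in> borel_measurable (\<mu> \<Otimes>\<^sub>M \<nu>)"
    and fst: "AE x in \<mu>. (\<integral>\<^sup>+y. h (x, y) \<partial>\<nu>) = 1"
    and snd: "AE y in \<nu>. (\<integral>\<^sup>+x. h (x, y) \<partial>\<mu>) = 1"
  shows "(\<lambda>p. p) \<in> density (\<mu> \<Otimes>\<^sub>M \<nu>) h \<rightarrow>\<^sub>M restrict_space borel (X \<times> X)"
    and "distr (density (\<mu> \<Otimes>\<^sub>M \<nu>) h) (restrict_space borel (X \<times> X)) (\<lambda>p. p) \<in> couplings X \<mu> \<nu>"
proof -
  let ?R = "restrict_space borel X :: 'a measure" and ?RR = "restrict_space borel (X \<times> X) :: ('a \<times> 'a) measure"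
  let ?D = "density (\<mu> \<Otimes>\<^sub>M \<nu>) h"
  interpret \<mu>: prob_space \<mu> using \<mu> by (rule borel_probD)
  interpret \<nu>: prob_space \<nu> using \<nu> by (rule borel_probD)
  interpret pair_sigma_finite \<mu> \<nu> ..
  note [simp] = borel_probD(2)[OF \<mu>] borel_probD(2)[OF \<nu>]
  note sets[measurable_cong] = borel_probD(3)[OF \<mu>] borel_probD(3)[OF \<nu>]
  have id_borel: "(\<lambda>x. x) \<in> ?R \<rightarrow>\<^sub>M borel"
    by (intro measurable_restrict_space1) simp
  have "(\<lambda>p. (fst p, snd p)) \<in> \<mu> \<Otimes>\<^sub>M \<nu> \<rightarrow>\<^sub>M (borel :: ('a \<times> 'a) measure)"
    using measurable_compose[OF measurable_fst[of \<mu> \<nu>], of "\<lambda>x. x" borel]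
      measurable_compose[OF measurable_snd[of \<mu> \<nu>], of "\<lambda>x. x" borel] id_borel sets
    by (intro borel_measurable_Pair) (simp_all cong: measurable_cong_sets)
  then show id: "(\<lambda>p. p) \<in> ?D \<rightarrow>\<^sub>M ?RR"
    by (intro measurable_restrict_space2) (auto simp: space_pair_measure)
  have fstM: "fst \<in> ?RR \<rightarrow>\<^sub>M ?R" and sndM: "snd \<in> ?RR \<rightarrow>\<^sub>M ?R"
    by (rule measurable_fst_restrict measurable_snd_restrict)+
  define \<pi> where "\<pi> = distr ?D ?RR (\<lambda>p. p)"
  have dfst: "distr \<pi> ?R fst = \<mu>"
  proof (rule measure_eqI)
    show "sets (distr \<pi> ?R fst) = sets \<mu>" by (simp add: sets)
    fix E assume "E \<in> sets (distr \<pi> ?R fst)"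
    then have E[measurable]: "E \<in> sets \<mu>" and E': "E \<in> sets ?R" by (simp_all add: sets)
    have "emeasure (distr \<pi> ?R fst) E = emeasure (distr ?D ?R fst) E"
      unfolding \<pi>_def using id fstM by (subst distr_distr) (auto simp: o_def)
    also have "\<dots> = emeasure ?D (fst -` E \<inter> space ?D)"
      using measurable_compose[OF id fstM] E' by (intro emeasure_distr) auto
    also have "fst -` E \<inter> space ?D = E \<times> X"
      using sets.sets_into_space[OF E] by (auto simp: space_pair_measure)
    also have "emeasure ?D (E \<times> X) = (\<integral>\<^sup>+p. h p * indicator (E \<times> X) p \<partial>(\<mu> \<Otimes>\<^sub>M \<nu>))"
      using sets.top[of \<nu>] by (intro emeasure_density h pair_measureI E) simp
    also have "\<dots> = (\<integral>\<^sup>+x. \<integral>\<^sup>+y. h (x, y) * indicator (E \<times> X) (x, y) \<partial>\<nu> \<partial>\<mu>)"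
      using sets.top[of \<nu>]
      by (intro \<nu>.nn_integral_fst[symmetric] borel_measurable_times_ennreal h borel_measurable_indicator pair_measureI E) simp
    also have "\<dots> = (\<integral>\<^sup>+x. indicator E x \<partial>\<mu>)"
    proof (rule nn_integral_cong_AE, use fst in eventually_elim)
      fix x assume x: "(\<integral>\<^sup>+y. h (x, y) \<partial>\<nu>) = 1"
      have "(\<integral>\<^sup>+y. h (x, y) * indicator (E \<times> X) (x, y) \<partial>\<nu>) = (\<integral>\<^sup>+y. h (x, y) * indicator E x \<partial>\<nu>)"
        by (intro nn_integral_cong) (simp add: indicator_def)
      also have "\<dots> = indicator E x"
        using x by (cases "x \<in> E") auto
      finally show "(\<integral>\<^sup>+y. h (x, y) * indicator (E \<times> X) (x, y) \<partial>\<nu>) = indicator E x" .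
    qed
    also have "\<dots> = emeasure \<mu> E" by simp
    finally show "emeasure (distr \<pi> ?R fst) E = emeasure \<mu> E" .
  qed
  have dsnd: "distr \<pi> ?R snd = \<nu>"
  proof (rule measure_eqI)
    show "sets (distr \<pi> ?R snd) = sets \<nu>" by (simp add: sets)
    fix E assume "E \<in> sets (distr \<pi> ?R snd)"
    then have E[measurable]: "E \<in> sets \<nu>" and E': "E \<in> sets ?R" by (simp_all add: sets)
    have "emeasure (distr \<pi> ?R snd) E = emeasure (distr ?D ?R snd) E"
      unfolding \<pi>_def using id sndM by (subst distr_distr) (auto simp: o_def)
    also have "\<dots> = emeasure ?D (snd -` E \<inter> space ?D)"
      using measurable_compose[OF id sndM] E' by (intro emeasure_distr) auto
    also have "snd -` E \<inter> space ?D = X \<times> E"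
      using sets.sets_into_space[OF E] by (auto simp: space_pair_measure)
    also have "emeasure ?D (X \<times> E) = (\<integral>\<^sup>+p. h p * indicator (X \<times> E) p \<partial>(\<mu> \<Otimes>\<^sub>M \<nu>))"
      using sets.top[of \<mu>] by (intro emeasure_density h pair_measureI E) simp
    also have "\<dots> = (\<integral>\<^sup>+y. \<integral>\<^sup>+x. h (x, y) * indicator (X \<times> E) (x, y) \<partial>\<mu> \<partial>\<nu>)"
      using sets.top[of \<mu>]
      by (intro nn_integral_snd[symmetric] borel_measurable_times_ennreal h borel_measurable_indicator pair_measureI E) simp
    also have "\<dots> = (\<integral>\<^sup>+y. indicator E y \<partial>\<nu>)"
    proof (rule nn_integral_cong_AE, use snd in eventually_elim)
      fix y assume y: "(\<integral>\<^sup>+x. h (x, y) \<partial>\<mu>) = 1"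
      have "(\<integral>\<^sup>+x. h (x, y) * indicator (X \<times> E) (x, y) \<partial>\<mu>) = (\<integral>\<^sup>+x. h (x, y) * indicator E y \<partial>\<mu>)"
        by (intro nn_integral_cong) (simp add: indicator_def)
      also have "\<dots> = indicator E y"
        using y by (cases "y \<in> E") auto
      finally show "(\<integral>\<^sup>+x. h (x, y) * indicator (X \<times> E) (x, y) \<partial>\<mu>) = indicator E y" .
    qed
    also have "\<dots> = emeasure \<nu> E" by simp
    finally show "emeasure (distr \<pi> ?R snd) E = emeasure \<nu> E" .
  qed
  have "prob_space \<pi>"
  proof (rule prob_space_distrD)
    show "fst \<in> \<pi> \<rightarrow>\<^sub>M ?R" using fstM by (simp add: \<pi>_def)
    show "prob_space (distr \<pi> ?R fst)" unfolding dfst by (rule \<mu>.prob_space_axioms)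
  qed
  then have "\<pi> \<in> borel_prob (X \<times> X)"
    by (simp add: borel_prob_def \<pi>_def space_restrict_space)
  then show "distr ?D ?RR (\<lambda>p. p) \<in> couplings X \<mu> \<nu>"
    using dfst dsnd by (simp add: couplings_def \<pi>_def)
qed

context compact_cost
begin

text \<open>The nontrivial half of Kantorovich duality, with an error \<open>e\<close>. A third of the error is spent on
  each of the following: passing from \<open>u\<close> to a continuous \<open>\<phi>\<close>, passing from \<open>v\<close> to a continuous \<open>\<psi>\<close>, and
  comparing \<open>c\<close> with its value at the rounded points.\<close>

lemma coupling_near_dual_bound:
  assumes \<mu>: "\<mu> \<in> borel_prob X" and \<nu>: "\<nu> \<in> borel_prob X"
    and M: "\<And>q. q \<in> dual_pairs X c \<Longrightarrow> dual_value \<mu> \<nu> q \<le> M" and e: "0 < e"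
  obtains \<pi> where "\<pi> \<in> couplings X \<mu> \<nu>" "(\<integral>(x, y). c x y \<partial>\<pi>) \<le> M + e"
proof -
  interpret \<mu>: prob_space \<mu> using \<mu> by (rule borel_probD)
  interpret \<nu>: prob_space \<nu> using \<nu> by (rule borel_probD)
  interpret pair_prob_space \<mu> \<nu> ..
  note [simp] = borel_probD(2)[OF \<mu>] borel_probD(2)[OF \<nu>]
  define e' where "e' = e / 3"
  have e': "0 < e'" using e by (simp add: e'_def)
  obtain d where d: "d > 0"
    and mod: "\<And>x x' y y'. \<lbrakk>x \<in> X; x' \<in> X; y \<in> X; y' \<in> X; dist x x' < d; dist y y' < d\<rbrakk>
       \<Longrightarrow> \<bar>c x y - c x' y'\<bar> < e'"
    using uniform_cost[OF e'] by auto
  obtain F and r :: "'a \<Rightarrow> 'a" where F: "finite F" "F \<subseteq> X" and r: "\<And>i. {x. r x = i} \<in> sets borel"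
    and rF: "\<And>x. x \<in> X \<Longrightarrow> r x \<in> F" and rd: "\<And>x. x \<in> X \<Longrightarrow> dist x (r x) < d"
    using finite_rounding[OF compact_space d] by blast
  have F_ne: "F \<noteq> {}" using rF nonempty by blast
  have rX: "r x \<in> X" if "x \<in> X" for x using rF[OF that] F by blast
  have r_sets: "{x \<in> X. r x = i} \<in> sets \<mu>" "{x \<in> X. r x = i} \<in> sets \<nu>" for i
  proof -
    have "X \<inter> {x. r x = i} \<in> sets (restrict_space borel X)"
      unfolding sets_restrict_space using r by (intro imageI)
    then show "{x \<in> X. r x = i} \<in> sets \<mu>" "{x \<in> X. r x = i} \<in> sets \<nu>"
      by (simp_all add: borel_probD(3)[OF \<mu>] borel_probD(3)[OF \<nu>] Int_def)
  qed
  define a where "a = (\<lambda>i. measure \<mu> {x \<in> X. r x = i})"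
  define b where "b = (\<lambda>i. measure \<nu> {x \<in> X. r x = i})"
  have nonneg: "0 \<le> a i" "0 \<le> b i" for i by (simp_all add: a_def b_def)
  have int\<mu>: "integrable \<mu> (\<lambda>x. g (r x))" "(\<integral>x. g (r x) \<partial>\<mu>) = (\<Sum>i\<in>F. a i * g i)"
   and int\<nu>: "integrable \<nu> (\<lambda>x. g (r x))" "(\<integral>x. g (r x) \<partial>\<nu>) = (\<Sum>i\<in>F. b i * g i)" for g :: "'a \<Rightarrow> real"
    using finite_range_integral[OF \<mu>.finite_measure_axioms F(1), of r g]
      finite_range_integral[OF \<nu>.finite_measure_axioms F(1), of r g] rF r_sets
    by (simp_all add: a_def b_def)
  have sum_ab: "sum a F = 1" "sum b F = 1"
    using int\<mu>(2)[of "\<lambda>_. 1"] int\<nu>(2)[of "\<lambda>_. 1"] \<mu>.prob_space \<nu>.prob_space by simp_all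
  have bound: "(\<Sum>i\<in>F. a i * u i) + (\<Sum>j\<in>F. b j * v j) \<le> M + 2 * e'"
    if uv: "\<And>i j. i \<in> F \<Longrightarrow> j \<in> F \<Longrightarrow> u i + v j \<le> c i j" for u v
  proof -
    \<comment> \<open>Extend \<open>v\<close> from the net by a \<open>c\<close>-transform over the net, and transform back over all of \<open>X\<close>;
      this makes both functions continuous and loses at most the oscillation of \<open>c\<close> over a cell.\<close>
    define \<phi> where "\<phi> = ctrans' F c v"
    define \<psi> where "\<psi> = ctrans X c \<phi>"
    have bdd: "bdd_above (v ` F)" using F by auto
    have c\<phi>: "continuous_on X \<phi>"
      unfolding \<phi>_def by (intro continuous_on_ctrans' F F_ne bdd)
    have c\<psi>: "continuous_on X \<psi>"
      unfolding \<psi>_def by (intro continuous_on_ctrans bdd_above_continuous c\<phi> nonempty subset_refl)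
    have \<phi>: "u (r x) - e' \<le> \<phi> x" if x: "x \<in> X" for x
      unfolding \<phi>_def
    proof (intro ctrans'_greatest F_ne)
      fix j assume j: "j \<in> F"
      have "\<bar>c x j - c (r x) j\<bar> < e'"
        using x j F rX[OF x] rd[OF x] d by (intro mod) auto
      then show "u (r x) - e' \<le> c x j - v j"
        using uv[OF rF[OF x] j] by simp
    qed
    have \<psi>: "v (r y) - e' \<le> \<psi> y" if y: "y \<in> X" for y
      unfolding \<psi>_def
    proof (intro ctrans_greatest nonempty)
      fix x assume x: "x \<in> X"
      have "\<bar>c x y - c x (r y)\<bar> < e'"
        using x y rX[OF y] rd[OF y] d by (intro mod) auto
      moreover have "\<phi> x \<le> c x (r y) - v (r y)"
        unfolding \<phi>_def by (intro ctrans'_le F bdd rF x y)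
      ultimately show "v (r y) - e' \<le> c x y - \<phi> x" by simp
    qed
    have "(\<phi>, \<psi>) \<in> dual_pairs X c"
      using c\<phi> c\<psi> ctrans_le[OF subset_refl bdd_above_continuous[OF c\<phi>]]
      by (auto simp: dual_pairs_def \<psi>_def le_diff_eq algebra_simps)
    then have "dual_value \<mu> \<nu> (\<phi>, \<psi>) \<le> M" by (rule M)
    moreover have "(\<integral>x. u (r x) - e' \<partial>\<mu>) \<le> (\<integral>x. \<phi> x \<partial>\<mu>)"
      using \<phi> by (intro integral_mono integrable_borel_prob_continuous[OF \<mu> compact_space c\<phi>])
        (auto simp: int\<mu>)
    moreover have "(\<integral>x. v (r x) - e' \<partial>\<nu>) \<le> (\<integral>x. \<psi> x \<partial>\<nu>)"
      using \<psi> by (intro integral_mono integrable_borel_prob_continuous[OF \<nu> compact_space c\<psi>])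
        (auto simp: int\<nu>)
    ultimately show ?thesis
      using \<mu>.prob_space \<nu>.prob_space
      by (simp add: dual_value_def int\<mu> int\<nu>)
  qed
  obtain w where w: "\<And>i j. i \<in> F \<Longrightarrow> j \<in> F \<Longrightarrow> 0 \<le> w i j"
    "\<And>i. i \<in> F \<Longrightarrow> (\<Sum>j\<in>F. w i j) = a i" "\<And>j. j \<in> F \<Longrightarrow> (\<Sum>i\<in>F. w i j) = b j"
    and cost_w: "(\<Sum>i\<in>F. \<Sum>j\<in>F. w i j * c i j) \<le> M + 2 * e'"
    by (rule discrete_transport_duality[OF F(1) nonneg(1) sum_ab(1) nonneg(2) sum_ab(2), of c "M + 2 * e'"])
      (use bound in auto)
  have w0: "w i j = 0" if "a i * b j = 0" "i \<in> F" "j \<in> F" for i j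
    using that w(2)[of i] w(3)[of j] F(1) w(1)
    by (auto simp: sum_nonneg_eq_0_iff)
  define k where "k = (\<lambda>(i, j). w i j / (a i * b j))"
  define R where "R = (\<lambda>(x, y). (r x, r y))"
  have k_nonneg: "0 \<le> k (i, j)" if "i \<in> F" "j \<in> F" for i j
    using w(1)[OF that] nonneg by (simp add: k_def)
  have R_eq: "{p \<in> X \<times> X. R p = (i, j)} = {x \<in> X. r x = i} \<times> {x \<in> X. r x = j}" for i j
    by (auto simp: R_def)
  have spc: "space (\<mu> \<Otimes>\<^sub>M \<nu>) = X \<times> X" by (simp add: space_pair_measure)
  have R_range: "R p \<in> F \<times> F" if "p \<in> space (\<mu> \<Otimes>\<^sub>M \<nu>)" for p
    using that rF by (auto simp: R_def spc)
  have R_sets: "{p \<in> space (\<mu> \<Otimes>\<^sub>M \<nu>). R p = q} \<in> sets (\<mu> \<Otimes>\<^sub>M \<nu>)" for q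
    using r_sets by (cases q) (auto simp: spc R_eq)
  have R_mass: "measure (\<mu> \<Otimes>\<^sub>M \<nu>) {p \<in> space (\<mu> \<Otimes>\<^sub>M \<nu>). R p = (i, j)} = a i * b j" for i j
    unfolding spc R_eq using r_sets
    by (simp add: measure_def \<nu>.emeasure_pair_measure_Times enn2real_mult a_def b_def)
  note intR = finite_range_integral[OF finite_measure_axioms finite_cartesian_product[OF F(1) F(1)] R_range R_sets]
  define h where "h = (\<lambda>p. ennreal (k (R p)))"
  have h: "h \<in> borel_measurable (\<mu> \<Otimes>\<^sub>M \<nu>)"
    unfolding h_def using intR(1)[of k] by simp
  have 1: "AE x in \<mu>. (\<integral>\<^sup>+y. h (x, y) \<partial>\<nu>) = 1"
    using step_plan_row_mass[OF \<mu>.finite_measure_axioms \<nu>.finite_measure_axioms F(1), of r w] rF r_sets w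
    by (simp add: h_def k_def R_def a_def b_def)
  have 2: "AE y in \<nu>. (\<integral>\<^sup>+x. h (x, y) \<partial>\<mu>) = 1"
    using step_plan_row_mass[OF \<nu>.finite_measure_axioms \<mu>.finite_measure_axioms F(1), of r "\<lambda>j i. w i j"] rF r_sets w
    by (simp add: h_def k_def R_def a_def b_def mult.commute)
  define \<pi> where "\<pi> = distr (density (\<mu> \<Otimes>\<^sub>M \<nu>) h) (restrict_space borel (X \<times> X)) (\<lambda>p. p)"
  note id = coupling_from_density(1)[OF \<mu> \<nu> h 1 2]
  have \<pi>: "\<pi> \<in> couplings X \<mu> \<nu>"
    unfolding \<pi>_def by (rule coupling_from_density(2)[OF \<mu> \<nu> h 1 2])
  have c_meas: "(\<lambda>(x, y). c x y) \<in> borel_measurable (restrict_space borel (X \<times> X))"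
    by (rule borel_measurable_continuous_on_restrict[OF continuous_cost])
  have c_meas': "(\<lambda>(x, y). c x y) \<in> borel_measurable (\<mu> \<Otimes>\<^sub>M \<nu>)"
    using measurable_compose[OF id c_meas] by simp
  have "(\<integral>(x, y). c x y \<partial>\<pi>) = (\<integral>(x, y). c x y \<partial>density (\<mu> \<Otimes>\<^sub>M \<nu>) h)"
    unfolding \<pi>_def by (rule integral_distr[OF id c_meas])
  also have "\<dots> = (\<integral>p. k (R p) *\<^sub>R (case p of (x, y) \<Rightarrow> c x y) \<partial>(\<mu> \<Otimes>\<^sub>M \<nu>))"
    unfolding h_def
  proof (rule integral_density[OF c_meas' intR(1)])
    show "AE p in \<mu> \<Otimes>\<^sub>M \<nu>. 0 \<le> k (R p)"
      using k_nonneg R_range by (intro AE_I2) (metis mem_Times_iff prod.collapse)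
  qed
  also have "\<dots> \<le> (\<integral>p. (\<lambda>(i, j). k (i, j) * (c i j + e')) (R p) \<partial>(\<mu> \<Otimes>\<^sub>M \<nu>))"
  proof (rule integral_mono')
    show "integrable (\<mu> \<Otimes>\<^sub>M \<nu>) (\<lambda>p. (\<lambda>(i, j). k (i, j) * (c i j + e')) (R p))"
      by (rule intR(2))
    fix p assume "p \<in> space (\<mu> \<Otimes>\<^sub>M \<nu>)"
    then obtain x y where p: "p = (x, y)" "x \<in> X" "y \<in> X" by (auto simp: spc)
    have "\<bar>c x y - c (r x) (r y)\<bar> < e'"
      using p rX rd by (intro mod) auto
    then have "c x y \<le> c (r x) (r y) + e'" by simp
    then show "k (R p) *\<^sub>R (case p of (x, y) \<Rightarrow> c x y) \<le> (\<lambda>(i, j). k (i, j) * (c i j + e')) (R p)"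
      using k_nonneg[OF rF rF] p by (simp add: R_def mult_left_mono)
    show "0 \<le> (\<lambda>(i, j). k (i, j) * (c i j + e')) (R p)"
      using k_nonneg[OF rF rF] p cost_nonneg[OF rX rX] e' by (simp add: R_def)
  qed
  also have "\<dots> = (\<Sum>q\<in>F \<times> F. measure (\<mu> \<Otimes>\<^sub>M \<nu>) {p \<in> space (\<mu> \<Otimes>\<^sub>M \<nu>). R p = q} *
      (\<lambda>(i, j). k (i, j) * (c i j + e')) q)"
    by (rule intR(3))
  also have "\<dots> = (\<Sum>i\<in>F. \<Sum>j\<in>F. a i * b j * (k (i, j) * (c i j + e')))"
    using R_mass by (auto simp: sum.cartesian_product intro!: sum.cong)
  also have "\<dots> = (\<Sum>i\<in>F. \<Sum>j\<in>F. w i j * c i j + w i j * e')"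
  proof (intro sum.cong refl)
    fix i j assume "i \<in> F" "j \<in> F"
    then have "a i * b j * k (i, j) = w i j"
      using w0[of i j] by (cases "a i * b j = 0") (auto simp: k_def)
    then show "a i * b j * (k (i, j) * (c i j + e')) = w i j * c i j + w i j * e'"
      by (simp add: mult.assoc[symmetric] distrib_left)
  qed
  also have "\<dots> = (\<Sum>i\<in>F. \<Sum>j\<in>F. w i j * c i j) + (\<Sum>i\<in>F. \<Sum>j\<in>F. w i j) * e'"
    by (simp add: sum.distrib sum_distrib_right)
  also have "(\<Sum>i\<in>F. \<Sum>j\<in>F. w i j) = 1"
    using w(2) sum_ab by (simp cong: sum.cong)
  also have "(\<Sum>i\<in>F. \<Sum>j\<in>F. w i j * c i j) + 1 * e' \<le> M + e"
    using cost_w by (simp add: e'_def)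
  finally show ?thesis using \<pi> that by blast
qed

lemma dual_value_le_cost:
  assumes \<pi>: "\<pi> \<in> couplings X \<mu> \<nu>" and q: "q \<in> dual_pairs X c"
  shows "dual_value \<mu> \<nu> q \<le> (\<integral>(x, y). c x y \<partial>\<pi>)"
proof -
  obtain \<phi> \<psi> where [simp]: "q = (\<phi>, \<psi>)" by fastforce
  have \<phi>: "continuous_on X \<phi>" "continuous_on X \<psi>"
    and le: "\<And>x y. x \<in> X \<Longrightarrow> y \<in> X \<Longrightarrow> \<phi> x + \<psi> y \<le> c x y"
    using q by (auto simp: dual_pairs_def)
  let ?R = "restrict_space borel X :: 'a measure"
  have \<pi>b: "\<pi> \<in> borel_prob (X \<times> X)" and fst: "distr \<pi> ?R fst = \<mu>" and snd: "distr \<pi> ?R snd = \<nu>"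
    using \<pi> by (auto simp: couplings_def)
  note [simp] = borel_probD(2)[OF \<pi>b]
  have "fst \<in> restrict_space borel (X \<times> X) \<rightarrow>\<^sub>M ?R" "snd \<in> restrict_space borel (X \<times> X) \<rightarrow>\<^sub>M ?R"
    by (rule measurable_fst_restrict measurable_snd_restrict)+
  then have M: "fst \<in> \<pi> \<rightarrow>\<^sub>M ?R" "snd \<in> \<pi> \<rightarrow>\<^sub>M ?R"
    using borel_probD(3)[OF \<pi>b] by (simp_all cong: measurable_cong_sets)
  have "dual_value \<mu> \<nu> q = (\<integral>p. \<phi> (fst p) \<partial>\<pi>) + (\<integral>p. \<psi> (snd p) \<partial>\<pi>)"
    using integral_distr[OF M(1) borel_measurable_continuous_on_restrict[OF \<phi>(1)]]
      integral_distr[OF M(2) borel_measurable_continuous_on_restrict[OF \<phi>(2)]]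
    by (simp add: dual_value_def fst snd)
  also have "\<dots> = (\<integral>p. \<phi> (fst p) + \<psi> (snd p) \<partial>\<pi>)"
    by (intro Bochner_Integration.integral_add[symmetric] integrable_borel_prob_continuous[OF \<pi>b]
        compact_Times compact_space continuous_on_compose2[OF \<phi>(1)] continuous_on_compose2[OF \<phi>(2)] continuous_intros) auto
  also have "\<dots> \<le> (\<integral>(x, y). c x y \<partial>\<pi>)"
    by (intro integral_mono integrable_borel_prob_continuous[OF \<pi>b] continuous_cost continuous_on_add
        compact_Times compact_space continuous_on_compose2[OF \<phi>(1)] continuous_on_compose2[OF \<phi>(2)] continuous_intros)
      (auto simp: le)
  finally show ?thesis .
qed

text \<open>Normalized pairs have values at most \<open>\<parallel>c\<parallel>\<^sub>\<infinity>\<close>, and every dual pair is dominated by one of them. The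
  finite supremum can then serve as \<open>M\<close> in \<open>coupling_near_dual_bound\<close>, which thereby produces a
  coupling.\<close>

lemma bdd_above_dual_value:
  assumes \<mu>: "\<mu> \<in> borel_prob X" and \<nu>: "\<nu> \<in> borel_prob X"
  shows "bdd_above (dual_value \<mu> \<nu> ` dual_pairs X c)"
proof (rule bdd_aboveI2)
  fix q assume "q \<in> dual_pairs X c"
  then obtain p where p: "p \<in> normalized_pairs X c" and le: "dual_value \<mu> \<nu> q \<le> dual_value \<mu> \<nu> p"
    by (rule dual_pair_improve[OF _ \<mu> \<nu>])
  obtain \<phi> \<psi> where p_eq: "p = (\<phi>, \<psi>)" by fastforce
  note \<phi> = p[unfolded p_eq normalized_pairs_iff]
  interpret \<mu>: prob_space \<mu> using \<mu> by (rule borel_probD)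
  interpret \<nu>: prob_space \<nu> using \<nu> by (rule borel_probD)
  have "(\<integral>x. \<phi> x \<partial>\<mu>) \<le> sup_norm_on X c"
    using \<phi> borel_probD(2)[OF \<mu>]
    by (intro \<mu>.integral_le_const integrable_borel_prob_continuous[OF \<mu> compact_space] AE_I2) auto
  moreover have "(\<integral>y. \<psi> y \<partial>\<nu>) \<le> 0"
    using \<phi> borel_probD(2)[OF \<nu>]
    by (intro \<nu>.integral_le_const integrable_borel_prob_continuous[OF \<nu> compact_space] AE_I2) auto
  ultimately show "dual_value \<mu> \<nu> q \<le> sup_norm_on X c"
    using le by (simp add: p_eq dual_value_def)
qed

lemma couplings_nonempty:
  assumes \<mu>: "\<mu> \<in> borel_prob X" and \<nu>: "\<nu> \<in> borel_prob X"
  shows "couplings X \<mu> \<nu> \<noteq> {}"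
  using coupling_near_dual_bound[OF \<mu> \<nu> cSUP_upper[OF _ bdd_above_dual_value[OF \<mu> \<nu>]] zero_less_one]
  by blast

lemma dual_value_le_transport_cost:
  assumes \<mu>: "\<mu> \<in> borel_prob X" and \<nu>: "\<nu> \<in> borel_prob X" and q: "q \<in> dual_pairs X c"
  shows "dual_value \<mu> \<nu> q \<le> transport_cost X c \<mu> \<nu>"
  unfolding transport_cost_def
  by (intro cINF_greatest couplings_nonempty \<mu> \<nu> dual_value_le_cost q)

text \<open>Kantorovich duality, in the form that is used below: every maximizer of the dual problem attains
  the transport cost.\<close>

lemma transport_cost_eq_dual_value:
  assumes \<mu>: "\<mu> \<in> borel_prob X" and \<nu>: "\<nu> \<in> borel_prob X"
    and p: "p \<in> kantorovich_potentials X c \<mu> \<nu>"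
  shows "transport_cost X c \<mu> \<nu> = dual_value \<mu> \<nu> p"
proof (rule antisym)
  have max: "\<And>q. q \<in> dual_pairs X c \<Longrightarrow> dual_value \<mu> \<nu> q \<le> dual_value \<mu> \<nu> p"
    and p': "p \<in> dual_pairs X c"
    using p by (auto simp: kantorovich_potentials_def)
  show "dual_value \<mu> \<nu> p \<le> transport_cost X c \<mu> \<nu>"
    by (rule dual_value_le_transport_cost[OF \<mu> \<nu> p'])
  show "transport_cost X c \<mu> \<nu> \<le> dual_value \<mu> \<nu> p"
  proof (rule field_le_epsilon)
    fix e :: real assume "0 < e"
    then obtain \<pi> where \<pi>: "\<pi> \<in> couplings X \<mu> \<nu>" "(\<integral>(x, y). c x y \<partial>\<pi>) \<le> dual_value \<mu> \<nu> p + e"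
      using coupling_near_dual_bound[OF \<mu> \<nu> max] by auto
    have "bdd_below ((\<lambda>\<pi>. \<integral>(x, y). c x y \<partial>\<pi>) ` couplings X \<mu> \<nu>)"
      by (intro bdd_belowI2[of _ "dual_value \<mu> \<nu> p"] dual_value_le_cost p')
    then show "transport_cost X c \<mu> \<nu> \<le> dual_value \<mu> \<nu> p + e"
      unfolding transport_cost_def using \<pi> by (rule cINF_lower2)
  qed
qed

end

section \<open>Differentiating integrals against a family of densities\<close>

lemma gderiv_gradient:
  fixes f :: "'b::euclidean_space \<Rightarrow> real"
  assumes "f differentiable (at x)"
  shows "GDERIV f x :> gradient f x"
proof -
  obtain D where D: "(f has_derivative D) (at x)"
    using assms by (auto simp: differentiable_def)
  interpret D: bounded_linear D using D by (rule has_derivative_bounded_linear)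
  define g where "g = (\<Sum>b\<in>Basis. D b *\<^sub>R b)"
  have D_eq: "D = (\<lambda>h. h \<bullet> g)"
  proof
    fix h
    have "D h = D (\<Sum>b\<in>Basis. (h \<bullet> b) *\<^sub>R b)" by (simp add: euclidean_representation)
    also have "\<dots> = h \<bullet> g"
      by (simp add: g_def D.sum D.scaleR inner_sum_right mult.commute)
    finally show "D h = h \<bullet> g" .
  qed
  have "GDERIV f x :> g"
    using D unfolding gderiv_def D_eq .
  moreover have "g = g'" if "GDERIV f x :> g" "GDERIV f x :> g'" for g g'
  proof -
    have "(\<lambda>h. h \<bullet> g) = (\<lambda>h. h \<bullet> g')"
      using that unfolding gderiv_def by (rule has_derivative_unique)
    from fun_cong[OF this, of "g - g'"] have "(g - g') \<bullet> (g - g') = 0"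
      by (simp add: inner_diff_right)
    then show ?thesis by simp
  qed
  ultimately have "\<exists>!g. GDERIV f x :> g" by blast
  then show ?thesis
    unfolding gradient_def by (rule theI')
qed

lemma gradient_difference_bound:
  fixes f :: "'b::euclidean_space \<Rightarrow> real"
  assumes "convex S" "x \<in> S" "y \<in> S"
    and f: "\<And>z. z \<in> S \<Longrightarrow> f differentiable (at z) \<and> norm (gradient f z) \<le> B"
  shows "\<bar>f x - f y\<bar> \<le> B * norm (x - y)"
proof -
  have "norm (f x - f y) \<le> B * norm (x - y)"
  proof (rule differentiable_bound[OF assms(1) _ _ assms(2,3)])
    fix z assume z: "z \<in> S"
    show "(f has_derivative (\<lambda>h. h \<bullet> gradient f z)) (at z within S)"
      using gderiv_gradient f[OF z] by (auto simp: gderiv_def intro: has_derivative_at_withinI)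
    show "onorm (\<lambda>h. h \<bullet> gradient f z) \<le> B"
    proof (rule onorm_le)
      fix h
      have "norm (h \<bullet> gradient f z) \<le> norm h * norm (gradient f z)"
        by (simp add: Cauchy_Schwarz_ineq2)
      also have "\<dots> \<le> B * norm h"
        using mult_left_mono[of "norm (gradient f z)" B "norm h"] f[OF z] by (simp add: mult.commute)
      finally show "norm (h \<bullet> gradient f z) \<le> B * norm h" .
    qed
  qed
  then show ?thesis by simp
qed

lemma difference_quotient_tendsto_gradient:
  fixes f :: "'b::euclidean_space \<Rightarrow> real"
  assumes f: "f differentiable (at x)" and t: "\<And>n :: nat. t n \<noteq> 0" "t \<longlonglongrightarrow> 0"
  shows "(\<lambda>n. (f (x + t n *\<^sub>R v) - f x) / t n) \<longlonglongrightarrow> gradient f x \<bullet> v"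
proof -
  have line: "((\<lambda>s. x + s *\<^sub>R v) has_derivative (\<lambda>h. h *\<^sub>R v)) (at 0)"
    by (auto intro!: derivative_eq_intros)
  have grad: "(f has_derivative (\<lambda>h. h \<bullet> gradient f x)) (at (x + 0 *\<^sub>R v))"
    using gderiv_gradient[OF f] by (simp add: gderiv_def)
  have "((\<lambda>s. f (x + s *\<^sub>R v)) has_derivative (\<lambda>h. (h *\<^sub>R v) \<bullet> gradient f x)) (at 0)"
    using has_derivative_compose[OF line grad] .
  moreover have "(\<lambda>h. (h *\<^sub>R v) \<bullet> gradient f x) = (*) (gradient f x \<bullet> v)"
    by (auto simp: inner_commute)
  ultimately have "((\<lambda>s. f (x + s *\<^sub>R v)) has_field_derivative gradient f x \<bullet> v) (at 0)"
    by (simp add: has_field_derivative_def)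
  then have "((\<lambda>h. (f (x + h *\<^sub>R v) - f x) / h) \<longlongrightarrow> gradient f x \<bullet> v) (at 0)"
    by (simp add: DERIV_def)
  moreover have "filterlim t (at 0) sequentially"
    using t by (simp add: filterlim_at)
  ultimately show ?thesis by (rule filterlim_compose)
qed

text \<open>Completeness of Lebesgue measure; gradients are only controlled almost everywhere.\<close>

lemma borel_measurable_lebesgue_on_AE:
  fixes f g :: "'a::euclidean_space \<Rightarrow> 'c::euclidean_space"
  assumes S: "S \<in> sets lebesgue" and f: "f \<in> borel_measurable (lebesgue_on S)"
    and ae: "AE x in lebesgue_on S. f x = g x"
  shows "g \<in> borel_measurable (lebesgue_on S)"
proof -
  have "AE x in lebesgue. x \<in> S \<longrightarrow> f x = g x"
    using ae S by (simp add: AE_restrict_space_iff)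
  then have "AE x in lebesgue. (if x \<in> S then f x else 0) = (if x \<in> S then g x else 0)"
    by eventually_elim simp
  from borel_measurable_AE[OF borel_measurable_if[OF S, THEN iffD2, OF f] this]
  show ?thesis by (rule borel_measurable_if[OF S, THEN iffD1])
qed

text \<open>The density describes \<open>\<mu>\<close> on Borel sets only and may itself be merely Lebesgue measurable. So \<open>\<mu>\<close> is
  identified with the image of the density measure under the identity, viewed as a map from the
  Lebesgue to the Borel \<open>\<sigma>\<close>-algebra, and integrals are transformed along it.\<close>

lemma
  fixes X :: "'a::euclidean_space set"
  assumes \<mu>: "\<mu> \<in> borel_prob X" and X: "X \<in> sets lebesgue" and r: "has_lebesgue_density X \<mu> r"
  shows lebesgue_density_integrable: "integrable (lebesgue_on X) r"
    and integral_lebesgue_density: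
      "continuous_on X \<phi> \<Longrightarrow> (\<integral>x. \<phi> x \<partial>\<mu>) = (\<integral>x. \<phi> x * r x \<partial>lebesgue_on X)"
proof -
  let ?L = "lebesgue_on X" and ?R = "restrict_space borel X :: 'a measure"
  have r_meas[measurable]: "r \<in> borel_measurable ?L" and r_nonneg: "AE x in ?L. 0 \<le> r x"
    and r_eq: "\<And>A. A \<in> sets \<mu> \<Longrightarrow> emeasure \<mu> A = (\<integral>\<^sup>+x\<in>A. ennreal (r x) \<partial>?L)"
    using r by (auto simp: has_lebesgue_density_def)
  note sets = borel_probD(3)[OF \<mu>]
  have spX: "space ?L = X" by (simp add: space_restrict_space)
  have id: "(\<lambda>x. x) \<in> ?L \<rightarrow>\<^sub>M ?R"
    using id_borel_measurable_lebesgue_on[of X]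
    by (intro measurable_restrict_space2) (auto simp: spX id_def)
  have idD: "(\<lambda>x. x) \<in> density ?L (\<lambda>x. ennreal (r x)) \<rightarrow>\<^sub>M ?R"
    using id by simp
  have \<mu>_eq: "\<mu> = distr (density ?L (\<lambda>x. ennreal (r x))) ?R (\<lambda>x. x)"
  proof (rule measure_eqI)
    fix A assume A: "A \<in> sets \<mu>"
    then have A': "A \<in> sets ?R" by (simp add: sets)
    have AX: "A \<subseteq> X" using sets.sets_into_space[OF A] borel_probD(2)[OF \<mu>] by simp
    have "A \<in> sets ?L"
      using measurable_sets[OF id A'] AX by (simp add: spX Int_absorb2)
    then show "emeasure \<mu> A = emeasure (distr (density ?L (\<lambda>x. ennreal (r x))) ?R (\<lambda>x. x)) A"
      using r_eq[OF A] AX by (simp add: emeasure_distr[OF idD A'] spX Int_absorb2 emeasure_density)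
  qed (simp add: sets)
  interpret \<mu>: prob_space \<mu> using \<mu> by (rule borel_probD)
  have "(\<integral>\<^sup>+x. ennreal (r x) \<partial>?L) = (\<integral>\<^sup>+x\<in>X. ennreal (r x) \<partial>?L)"
    by (intro nn_integral_cong) (simp add: spX)
  also have "\<dots> = 1"
    using r_eq[of X] \<mu>.emeasure_space_1 sets.top[of \<mu>] borel_probD(2)[OF \<mu>] by simp
  finally show "integrable ?L r"
    by (intro integrableI_nonneg r_meas r_nonneg) simp
  assume \<phi>: "continuous_on X \<phi>"
  have \<phi>R: "\<phi> \<in> borel_measurable ?R"
    by (rule borel_measurable_continuous_on_restrict[OF \<phi>])
  have "(\<integral>x. \<phi> x \<partial>\<mu>) = (\<integral>x. \<phi> x \<partial>density ?L (\<lambda>x. ennreal (r x)))"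
    by (subst \<mu>_eq) (rule integral_distr[OF idD \<phi>R])
  also have "\<dots> = (\<integral>x. r x *\<^sub>R \<phi> x \<partial>?L)"
    using measurable_compose[OF id \<phi>R] by (intro integral_density r_meas r_nonneg)
  finally show "(\<integral>x. \<phi> x \<partial>\<mu>) = (\<integral>x. \<phi> x * r x \<partial>?L)"
    by (simp add: mult.commute)
qed

text \<open>The family of sources \<open>P \<theta>\<close> with densities \<open>\<rho> \<cdot> \<theta>\<close>, a fixed target \<open>\<nu>\<close>, and a majorant \<open>\<eta>\<close> for the
  gradients that serves all parameters at once.\<close>

locale transport_family = compact_cost X c
  for X :: "'a::euclidean_space set" and c +
  fixes \<Theta> :: "'b::euclidean_space set"
    and P :: "'b \<Rightarrow> 'a measure" and \<rho> :: "'a \<Rightarrow> 'b \<Rightarrow> real"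
    and \<nu> :: "'a measure" and \<eta> :: "'a \<Rightarrow> real"
  assumes target: "\<nu> \<in> borel_prob X"
    and open_parameters: "open \<Theta>"
    and source: "\<And>\<theta>. \<theta> \<in> \<Theta> \<Longrightarrow> P \<theta> \<in> borel_prob X"
    and density: "\<And>\<theta>. \<theta> \<in> \<Theta> \<Longrightarrow> has_lebesgue_density X (P \<theta>) (\<lambda>x. \<rho> x \<theta>)"
    and integrable_\<eta>: "integrable (lebesgue_on X) \<eta>"
    and gradient_bound: "AE x in lebesgue_on X. \<forall>\<theta>\<in>\<Theta>. \<rho> x differentiable (at \<theta>) \<and> norm (gradient (\<rho> x) \<theta>) \<le> \<eta> x"
begin

lemma X_lebesgue: "X \<in> sets lebesgue"
  using compact_space by (simp add: borel_compact)

lemma density_measurable: "\<theta> \<in> \<Theta> \<Longrightarrow> (\<lambda>x. \<rho> x \<theta>) \<in> borel_measurable (lebesgue_on X)"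
  using density by (auto simp: has_lebesgue_density_def)

text \<open>Whole segments have to stay in \<open>\<Theta>\<close> because the mean value inequality is applied along them.\<close>

lemma segment_in_parameters:
  assumes "\<theta> \<in> \<Theta>"
  shows "\<exists>d>0. \<forall>t. 0 < t \<and> t < d \<longrightarrow> closed_segment \<theta> (\<theta> + t *\<^sub>R v) \<subseteq> \<Theta>"
proof -
  obtain e where e: "e > 0" "ball \<theta> e \<subseteq> \<Theta>"
    using open_parameters assms by (auto simp: open_contains_ball)
  have seg: "closed_segment \<theta> (\<theta> + t *\<^sub>R v) \<subseteq> \<Theta>" if "0 < t" "t < e / (norm v + 1)" for t
  proof -
    have "t * norm v \<le> t * (norm v + 1)" using that by (intro mult_left_mono) auto
    also have "\<dots> < e" using that by (simp add: pos_less_divide_eq add_nonneg_pos)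
    finally have "\<theta> + t *\<^sub>R v \<in> ball \<theta> e" using that by (simp add: dist_norm)
    then have "closed_segment \<theta> (\<theta> + t *\<^sub>R v) \<subseteq> ball \<theta> e"
      using e by (intro closed_segment_subset convex_ball) auto
    then show ?thesis using e(2) by (rule order_trans)
  qed
  moreover have "0 < e / (norm v + 1)" using e by (simp add: add_nonneg_pos)
  ultimately show ?thesis by (intro exI[of _ "e / (norm v + 1)"]) simp
qed

text \<open>Each component of the gradient is almost everywhere a limit of difference quotients along a
  sequence of parameters. Without measurability the Bochner integral that defines
  \<^const>\<open>weighted_gradient\<close> would have the default value \<open>0\<close>.\<close>

lemma gradient_measurable:
  assumes \<theta>: "\<theta> \<in> \<Theta>"
  shows "(\<lambda>x. gradient (\<rho> x) \<theta>) \<in> borel_measurable (lebesgue_on X)"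
  unfolding borel_measurable_euclidean_space[of "\<lambda>x. gradient (\<rho> x) \<theta>"]
proof
  fix v :: 'b
  obtain d where d: "0 < d" and seg: "\<forall>t. 0 < t \<and> t < d \<longrightarrow> closed_segment \<theta> (\<theta> + t *\<^sub>R v) \<subseteq> \<Theta>"
    using segment_in_parameters[OF \<theta>, of v] by auto
  define t where "t = (\<lambda>n. d / 2 * inverse (real (Suc n)))"
  have t: "0 < t n" "t n < d" for n
  proof -
    show "0 < t n" using d by (simp add: t_def)
    have "t n \<le> d / 2" using d by (simp add: t_def field_simps)
    then show "t n < d" using d by simp
  qed
  have t0: "t \<longlonglongrightarrow> 0"
    unfolding t_def using tendsto_mult[OF tendsto_const LIMSEQ_inverse_real_of_nat, of "d / 2"] by simp
  define q where "q = (\<lambda>n x. (\<rho> x (\<theta> + t n *\<^sub>R v) - \<rho> x \<theta>) / t n)"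
  have "\<theta> + t n *\<^sub>R v \<in> \<Theta>" for n
    using seg t[of n] by (auto dest: spec[of _ "t n"])
  then have "q n \<in> borel_measurable (lebesgue_on X)" for n
    unfolding q_def using \<theta>
    by (intro borel_measurable_divide borel_measurable_diff density_measurable borel_measurable_const)
  then have lim: "(\<lambda>x. lim (\<lambda>n. q n x)) \<in> borel_measurable (lebesgue_on X)"
    by (rule borel_measurable_lim_metric)
  have "AE x in lebesgue_on X. lim (\<lambda>n. q n x) = gradient (\<rho> x) \<theta> \<bullet> v"
    using gradient_bound
  proof eventually_elim
    fix x assume "\<forall>\<theta>\<in>\<Theta>. \<rho> x differentiable (at \<theta>) \<and> norm (gradient (\<rho> x) \<theta>) \<le> \<eta> x"
    then have "\<rho> x differentiable (at \<theta>)" using \<theta> by blast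
    moreover have "t n \<noteq> 0" for n using t(1)[of n] by simp
    ultimately show "lim (\<lambda>n. q n x) = gradient (\<rho> x) \<theta> \<bullet> v"
      unfolding q_def by (intro limI difference_quotient_tendsto_gradient t0)
  qed
  then show "(\<lambda>x. gradient (\<rho> x) \<theta> \<bullet> v) \<in> borel_measurable (lebesgue_on X)"
    by (rule borel_measurable_lebesgue_on_AE[OF X_lebesgue lim])
qed

lemma continuous_measurable_lebesgue:
  fixes \<phi> :: "'a \<Rightarrow> real"
  assumes "continuous_on X \<phi>" shows "\<phi> \<in> borel_measurable (lebesgue_on X)"
  using assms X_lebesgue by (rule continuous_imp_measurable_on_sets_lebesgue)

lemma
  assumes \<theta>: "\<theta> \<in> \<Theta>" and \<phi>: "continuous_on X \<phi>" and B: "\<And>x. x \<in> X \<Longrightarrow> \<bar>\<phi> x\<bar> \<le> B"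
  shows integrable_weighted_gradient: "integrable (lebesgue_on X) (\<lambda>x. \<phi> x *\<^sub>R gradient (\<rho> x) \<theta>)"
    and weighted_gradient_inner:
      "weighted_gradient X \<rho> \<theta> \<phi> \<bullet> v = (\<integral>x. \<phi> x * (gradient (\<rho> x) \<theta> \<bullet> v) \<partial>lebesgue_on X)"
    and norm_weighted_gradient_le:
      "norm (weighted_gradient X \<rho> \<theta> \<phi>) \<le> B * (\<integral>x. \<eta> x \<partial>lebesgue_on X)"
proof -
  obtain x0 where "x0 \<in> X" using nonempty by blast
  from B[OF this] have B_nonneg: "0 \<le> B" by linarith
  have bound: "AE x in lebesgue_on X. norm (\<phi> x *\<^sub>R gradient (\<rho> x) \<theta>) \<le> B * \<eta> x"
  proof (rule AE_mp[OF gradient_bound], intro AE_I2 impI)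
    fix x assume x: "x \<in> space (lebesgue_on X)"
      and "\<forall>\<theta>\<in>\<Theta>. \<rho> x differentiable (at \<theta>) \<and> norm (gradient (\<rho> x) \<theta>) \<le> \<eta> x"
    then have "norm (gradient (\<rho> x) \<theta>) \<le> \<eta> x" using \<theta> by blast
    then show "norm (\<phi> x *\<^sub>R gradient (\<rho> x) \<theta>) \<le> B * \<eta> x"
      using B[of x] x B_nonneg by (auto simp: space_restrict_space intro!: mult_mono)
  qed
  have int_B: "integrable (lebesgue_on X) (\<lambda>x. B * \<eta> x)" using integrable_\<eta> by simp
  show int: "integrable (lebesgue_on X) (\<lambda>x. \<phi> x *\<^sub>R gradient (\<rho> x) \<theta>)"
  proof (rule Bochner_Integration.integrable_bound[OF int_B])
    show "(\<lambda>x. \<phi> x *\<^sub>R gradient (\<rho> x) \<theta>) \<in> borel_measurable (lebesgue_on X)"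
      by (rule borel_measurable_scaleR[OF continuous_measurable_lebesgue[OF \<phi>] gradient_measurable[OF \<theta>]])
    show "AE x in lebesgue_on X. norm (\<phi> x *\<^sub>R gradient (\<rho> x) \<theta>) \<le> norm (B * \<eta> x)"
      by (rule eventually_mono[OF bound]) (erule order_trans, unfold real_norm_def, rule abs_ge_self)
  qed
  then show "weighted_gradient X \<rho> \<theta> \<phi> \<bullet> v = (\<integral>x. \<phi> x * (gradient (\<rho> x) \<theta> \<bullet> v) \<partial>lebesgue_on X)"
    unfolding weighted_gradient_def
    by (subst integral_inner_left[symmetric]) auto
  have "norm (weighted_gradient X \<rho> \<theta> \<phi>) \<le> (\<integral>x. norm (\<phi> x *\<^sub>R gradient (\<rho> x) \<theta>) \<partial>lebesgue_on X)"
    unfolding weighted_gradient_def by (rule integral_norm_bound)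
  also have "\<dots> \<le> (\<integral>x. B * \<eta> x \<partial>lebesgue_on X)"
    by (intro integral_mono_AE integrable_norm int int_B bound)
  finally show "norm (weighted_gradient X \<rho> \<theta> \<phi>) \<le> B * (\<integral>x. \<eta> x \<partial>lebesgue_on X)"
    by simp
qed

text \<open>The integrand varies together with the parameter, since below the potentials move with \<open>t\<close>.
  Written with densities, the quotient is the integral of \<open>\<phi> n x\<close> times a difference quotient of
  \<open>\<rho> x\<close>, which is bounded by \<open>B \<cdot> \<eta> x \<cdot> \<parallel>v\<parallel>\<close> according to the mean value inequality.\<close>

lemma source_quotient_tendsto:
  assumes \<theta>: "\<theta> \<in> \<Theta>" and t: "\<And>n :: nat. 0 < t n" "t \<longlonglongrightarrow> 0"
    and seg: "\<And>n. closed_segment \<theta> (\<theta> + t n *\<^sub>R v) \<subseteq> \<Theta>"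
    and \<phi>: "\<And>n. continuous_on X (\<phi> n)" "continuous_on X \<phi>'"
    and B: "\<And>n x. x \<in> X \<Longrightarrow> \<bar>\<phi> n x\<bar> \<le> B"
    and lim: "\<And>x. x \<in> X \<Longrightarrow> (\<lambda>n. \<phi> n x) \<longlonglongrightarrow> \<phi>' x"
  shows "(\<lambda>n. ((\<integral>x. \<phi> n x \<partial>P (\<theta> + t n *\<^sub>R v)) - (\<integral>x. \<phi> n x \<partial>P \<theta>)) / t n)
      \<longlonglongrightarrow> weighted_gradient X \<rho> \<theta> \<phi>' \<bullet> v"
proof -
  let ?L = "lebesgue_on X"
  obtain x0 where "x0 \<in> X" using nonempty by blast
  from B[OF this, of 0] have B_nonneg: "0 \<le> B" by linarith
  have \<theta>n: "\<theta> + t n *\<^sub>R v \<in> \<Theta>" for n using seg[of n] by auto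
  have B': "\<bar>\<phi>' x\<bar> \<le> B" if "x \<in> X" for x
    by (rule LIMSEQ_le_const2[OF tendsto_rabs[OF lim[OF that]]]) (use B[OF that] in auto)
  have int: "integrable ?L (\<lambda>x. \<phi> n x * \<rho> x \<theta>')" if \<theta>': "\<theta>' \<in> \<Theta>" for n \<theta>'
  proof (rule Bochner_Integration.integrable_bound)
    show "integrable ?L (\<lambda>x. B * \<rho> x \<theta>')"
      using lebesgue_density_integrable[OF source[OF \<theta>'] X_lebesgue density[OF \<theta>']] by simp
    show "(\<lambda>x. \<phi> n x * \<rho> x \<theta>') \<in> borel_measurable ?L"
      by (rule borel_measurable_times[OF continuous_measurable_lebesgue[OF \<phi>(1)] density_measurable[OF \<theta>']])
    show "AE x in ?L. norm (\<phi> n x * \<rho> x \<theta>') \<le> norm (B * \<rho> x \<theta>')"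
      using B B_nonneg by (intro AE_I2) (auto simp: space_restrict_space abs_mult intro!: mult_right_mono)
  qed
  have eq: "((\<integral>x. \<phi> n x \<partial>P (\<theta> + t n *\<^sub>R v)) - (\<integral>x. \<phi> n x \<partial>P \<theta>)) / t n
      = (\<integral>x. \<phi> n x * ((\<rho> x (\<theta> + t n *\<^sub>R v) - \<rho> x \<theta>) / t n) \<partial>?L)" for n
    using int[OF \<theta>n[of n], of n] int[OF \<theta>, of n]
    by (simp add: integral_lebesgue_density[OF source X_lebesgue density \<phi>(1)] \<theta> \<theta>n
        right_diff_distrib diff_divide_distrib)
  have limit_eq: "weighted_gradient X \<rho> \<theta> \<phi>' \<bullet> v = (\<integral>x. \<phi>' x * (gradient (\<rho> x) \<theta> \<bullet> v) \<partial>?L)"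
    by (rule weighted_gradient_inner[OF \<theta> \<phi>(2) B'])
  show ?thesis
    unfolding eq limit_eq
  proof (rule integral_dominated_convergence[where w = "\<lambda>x. B * (\<eta> x * norm v)"])
    show "(\<lambda>x. \<phi>' x * (gradient (\<rho> x) \<theta> \<bullet> v)) \<in> borel_measurable ?L"
      by (rule borel_measurable_times[OF continuous_measurable_lebesgue[OF \<phi>(2)]
            borel_measurable_inner[OF gradient_measurable[OF \<theta>] borel_measurable_const]])
    show "(\<lambda>x. \<phi> n x * ((\<rho> x (\<theta> + t n *\<^sub>R v) - \<rho> x \<theta>) / t n)) \<in> borel_measurable ?L" for n
      by (rule borel_measurable_times[OF continuous_measurable_lebesgue[OF \<phi>(1)]
            borel_measurable_divide[OF borel_measurable_diff[OF density_measurable[OF \<theta>n] density_measurable[OF \<theta>]]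
            borel_measurable_const]])
    show "integrable ?L (\<lambda>x. B * (\<eta> x * norm v))"
      using integrable_\<eta> by simp
    show "AE x in ?L. (\<lambda>n. \<phi> n x * ((\<rho> x (\<theta> + t n *\<^sub>R v) - \<rho> x \<theta>) / t n))
        \<longlonglongrightarrow> \<phi>' x * (gradient (\<rho> x) \<theta> \<bullet> v)"
    proof (rule AE_mp[OF gradient_bound], intro AE_I2 impI)
      fix x assume "x \<in> space ?L"
        and "\<forall>\<theta>\<in>\<Theta>. \<rho> x differentiable (at \<theta>) \<and> norm (gradient (\<rho> x) \<theta>) \<le> \<eta> x"
      then have "x \<in> X" "\<rho> x differentiable (at \<theta>)" using \<theta> by (auto simp: space_restrict_space)
      moreover have "t n \<noteq> 0" for n using t(1)[of n] by simp
      ultimately show "(\<lambda>n. \<phi> n x * ((\<rho> x (\<theta> + t n *\<^sub>R v) - \<rho> x \<theta>) / t n))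
          \<longlonglongrightarrow> \<phi>' x * (gradient (\<rho> x) \<theta> \<bullet> v)"
        by (intro tendsto_mult lim difference_quotient_tendsto_gradient t(2))
    qed
    show "AE x in ?L. norm (\<phi> n x * ((\<rho> x (\<theta> + t n *\<^sub>R v) - \<rho> x \<theta>) / t n)) \<le> B * (\<eta> x * norm v)" for n
    proof (rule AE_mp[OF gradient_bound], intro AE_I2 impI)
      fix x assume "x \<in> space ?L"
        and g: "\<forall>\<theta>\<in>\<Theta>. \<rho> x differentiable (at \<theta>) \<and> norm (gradient (\<rho> x) \<theta>) \<le> \<eta> x"
      then have x: "x \<in> X" by (simp add: space_restrict_space)
      have "\<bar>\<rho> x (\<theta> + t n *\<^sub>R v) - \<rho> x \<theta>\<bar> \<le> \<eta> x * norm ((\<theta> + t n *\<^sub>R v) - \<theta>)"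
        using g seg[of n] by (intro gradient_difference_bound[where S = "closed_segment \<theta> (\<theta> + t n *\<^sub>R v)"]) auto
      then have "\<bar>(\<rho> x (\<theta> + t n *\<^sub>R v) - \<rho> x \<theta>) / t n\<bar> \<le> \<eta> x * norm v"
        using t(1)[of n] by (simp add: abs_divide divide_le_eq mult_ac)
      then show "norm (\<phi> n x * ((\<rho> x (\<theta> + t n *\<^sub>R v) - \<rho> x \<theta>) / t n)) \<le> B * (\<eta> x * norm v)"
        unfolding real_norm_def abs_mult using B[OF x] B_nonneg by (intro mult_mono) auto
    qed
  qed
qed

end

section \<open>Directional derivatives of the transport cost\<close>

text \<open>Reduces limits from the right to sequences, to which compactness and dominated convergence
  apply.\<close>

lemma not_eventually_at_right_sequence:
  assumes "\<not> eventually Q (at_right (0 :: real))" and "0 < d"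
  shows "\<exists>t :: nat \<Rightarrow> real. (\<forall>n. 0 < t n \<and> t n < d \<and> \<not> Q (t n)) \<and> t \<longlonglongrightarrow> 0"
proof -
  have "\<exists>s. 0 < s \<and> s < min d (inverse (real (Suc n))) \<and> \<not> Q s" for n
  proof (rule ccontr)
    assume "\<not> ?thesis"
    then have "eventually Q (at_right 0)"
      using \<open>0 < d\<close> unfolding eventually_at_right_field
      by (intro exI[of _ "min d (inverse (real (Suc n)))"]) auto
    with assms(1) show False by contradiction
  qed
  then obtain t where t: "\<And>n. 0 < t n \<and> t n < min d (inverse (real (Suc n))) \<and> \<not> Q (t n)"
    by metis
  have "t \<longlonglongrightarrow> 0"
    by (rule tendsto_sandwich[OF _ _ tendsto_const LIMSEQ_inverse_real_of_nat])
      (use t in \<open>auto intro!: always_eventually intro: less_imp_le\<close>)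
  then show ?thesis using t by (intro exI[of _ t]) simp
qed

context transport_family
begin

text \<open>A potential at \<open>\<theta>\<close> remains a dual pair at \<open>\<theta> + t v\<close>, so the increment of \<open>f\<close> is at least that of
  \<open>\<integral>\<phi> dP(\<cdot>)\<close>. Stated for all Kantorovich potentials, normalized or not, because the formula for
  the gradient concerns all of them.\<close>

lemma potential_subgradient:
  assumes f: "\<And>\<theta>. \<theta> \<in> \<Theta> \<Longrightarrow> f \<theta> = transport_cost X c (P \<theta>) \<nu>"
    and \<theta>: "\<theta> \<in> \<Theta>" and p: "(\<phi>, \<psi>) \<in> kantorovich_potentials X c (P \<theta>) \<nu>"
    and t: "\<And>n :: nat. 0 < t n" "t \<longlonglongrightarrow> 0"
    and seg: "\<And>n. closed_segment \<theta> (\<theta> + t n *\<^sub>R v) \<subseteq> \<Theta>"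
    and le: "\<And>n. (f (\<theta> + t n *\<^sub>R v) - f \<theta>) / t n \<le> a"
  shows "weighted_gradient X \<rho> \<theta> \<phi> \<bullet> v \<le> a"
proof -
  have q: "(\<phi>, \<psi>) \<in> dual_pairs X c"
    using p by (simp add: kantorovich_potentials_def)
  then have \<phi>: "continuous_on X \<phi>" by (simp add: dual_pairs_def)
  have "bounded (\<phi> ` X)"
    using compact_continuous_image[OF \<phi> compact_space] by (rule compact_imp_bounded)
  then obtain B where B: "\<And>x. x \<in> X \<Longrightarrow> \<bar>\<phi> x\<bar> \<le> B"
    by (auto simp: bounded_iff)
  have "(\<lambda>n. ((\<integral>x. \<phi> x \<partial>P (\<theta> + t n *\<^sub>R v)) - (\<integral>x. \<phi> x \<partial>P \<theta>)) / t n)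
      \<longlonglongrightarrow> weighted_gradient X \<rho> \<theta> \<phi> \<bullet> v"
    by (rule source_quotient_tendsto[OF \<theta> t seg \<phi> \<phi> B tendsto_const])
  then show ?thesis
  proof (rule LIMSEQ_le_const2, intro exI allI impI)
    fix n :: nat
    have \<theta>n: "\<theta> + t n *\<^sub>R v \<in> \<Theta>" using seg[of n] by auto
    have "dual_value (P (\<theta> + t n *\<^sub>R v)) \<nu> (\<phi>, \<psi>) \<le> f (\<theta> + t n *\<^sub>R v)"
      unfolding f[OF \<theta>n] by (rule dual_value_le_transport_cost[OF source[OF \<theta>n] target q])
    moreover have "dual_value (P \<theta>) \<nu> (\<phi>, \<psi>) = f \<theta>"
      unfolding f[OF \<theta>] by (rule transport_cost_eq_dual_value[OF source[OF \<theta>] target p, symmetric])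
    ultimately have "(\<integral>x. \<phi> x \<partial>P (\<theta> + t n *\<^sub>R v)) - (\<integral>x. \<phi> x \<partial>P \<theta>) \<le> f (\<theta> + t n *\<^sub>R v) - f \<theta>"
      by (simp add: dual_value_def)
    then have "((\<integral>x. \<phi> x \<partial>P (\<theta> + t n *\<^sub>R v)) - (\<integral>x. \<phi> x \<partial>P \<theta>)) / t n
        \<le> (f (\<theta> + t n *\<^sub>R v) - f \<theta>) / t n"
      using t(1)[of n] by (intro divide_right_mono) auto
    then show "((\<integral>x. \<phi> x \<partial>P (\<theta> + t n *\<^sub>R v)) - (\<integral>x. \<phi> x \<partial>P \<theta>)) / t n \<le> a"
      using le by (rule order_trans)
  qed
qed

text \<open>Choose normalized potentials \<open>p n\<close> at \<open>\<theta> + t n v\<close> and a limit \<open>q\<close> of a subsequence. The dual values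
  at \<open>\<theta> + t n v\<close> and at \<open>\<theta>\<close> differ by \<open>t n\<close> times a convergent quotient, so \<open>q\<close> is a potential at
  \<open>\<theta>\<close>. As \<open>p n\<close> is a competitor at \<open>\<theta>\<close>, the quotient of \<open>f\<close> is at most the quotient of
  \<open>\<integral>\<phi> dP(\<cdot>)\<close> for \<open>p n\<close>, which tends to the value at \<open>q\<close>.\<close>

lemma limit_potential_bounds_quotient:
  assumes f: "\<And>\<theta>. \<theta> \<in> \<Theta> \<Longrightarrow> f \<theta> = transport_cost X c (P \<theta>) \<nu>"
    and \<theta>: "\<theta> \<in> \<Theta>" and t: "\<And>n :: nat. 0 < t n" "t \<longlonglongrightarrow> 0"
    and seg: "\<And>n. closed_segment \<theta> (\<theta> + t n *\<^sub>R v) \<subseteq> \<Theta>"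
    and ge: "\<And>n. a \<le> (f (\<theta> + t n *\<^sub>R v) - f \<theta>) / t n"
  shows "\<exists>q\<in>normalized_potentials X c (P \<theta>) \<nu>. a \<le> weighted_gradient X \<rho> \<theta> (fst q) \<bullet> v"
proof -
  define \<theta>n where "\<theta>n = (\<lambda>n. \<theta> + t n *\<^sub>R v)"
  have \<theta>n: "\<theta>n n \<in> \<Theta>" for n using seg[of n] by (auto simp: \<theta>n_def)
  have "\<exists>p. p \<in> normalized_potentials X c (P (\<theta>n n)) \<nu>" for n
    by (rule normalized_potentials_nonempty[OF source[OF \<theta>n[of n]] target bdd_above_dual_value[OF source[OF \<theta>n[of n]] target]])
      (rule exI)
  then obtain p where p: "\<And>n. p n \<in> normalized_potentials X c (P (\<theta>n n)) \<nu>"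
    by metis
  then have norm_p: "p n \<in> normalized_pairs X c"
    and max_p: "p n \<in> kantorovich_potentials X c (P (\<theta>n n)) \<nu>" for n
    by (auto simp: normalized_potentials_def)
  obtain k q where k: "strict_mono k" and q: "q \<in> normalized_pairs X c"
    and lim: "\<forall>x\<in>X. (\<lambda>n. fst (p (k n)) x) \<longlonglongrightarrow> fst q x"
      "\<forall>y\<in>X. (\<lambda>n. snd (p (k n)) y) \<longlonglongrightarrow> snd q y"
    using normalized_pairs_compact[of p, OF norm_p] by auto
  have props: "continuous_on X (fst r)" "x \<in> X \<Longrightarrow> \<bar>fst r x\<bar> \<le> sup_norm_on X c"
    if "r \<in> normalized_pairs X c" for r x
    using that by (cases r; force simp: normalized_pairs_iff)+
  have tk: "(\<lambda>n. t (k n)) \<longlonglongrightarrow> 0"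
    using LIMSEQ_subseq_LIMSEQ[OF t(2) k] by (simp add: o_def)
  define Q where "Q = (\<lambda>n. ((\<integral>x. fst (p (k n)) x \<partial>P (\<theta>n (k n))) - (\<integral>x. fst (p (k n)) x \<partial>P \<theta>)) / t (k n))"
  have Q: "Q \<longlonglongrightarrow> weighted_gradient X \<rho> \<theta> (fst q) \<bullet> v"
    unfolding Q_def \<theta>n_def
    by (rule source_quotient_tendsto[OF \<theta> t(1) tk seg props(1)[OF norm_p] props(1)[OF q] props(2)[OF norm_p] lim(1)[rule_format]])
  have gap: "dual_value (P (\<theta>n (k n))) \<nu> (p (k n)) = dual_value (P \<theta>) \<nu> (p (k n)) + t (k n) * Q n" for n
    using t(1)[of "k n"] by (simp add: Q_def dual_value_def case_prod_unfold)
  have dual_lim: "(\<lambda>n. dual_value (P \<theta>) \<nu> (p (k n))) \<longlonglongrightarrow> dual_value (P \<theta>) \<nu> q"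
    by (rule dual_value_tendsto[OF source[OF \<theta>] target norm_p q lim[rule_format]])
  have "(\<lambda>n. dual_value (P \<theta>) \<nu> (p (k n)) + t (k n) * Q n) \<longlonglongrightarrow> dual_value (P \<theta>) \<nu> q + 0 * (weighted_gradient X \<rho> \<theta> (fst q) \<bullet> v)"
    by (intro tendsto_add tendsto_mult dual_lim tk Q)
  then have moving_lim: "(\<lambda>n. dual_value (P (\<theta>n (k n))) \<nu> (p (k n))) \<longlonglongrightarrow> dual_value (P \<theta>) \<nu> q"
    by (simp add: gap)
  have q_max: "dual_value (P \<theta>) \<nu> r \<le> dual_value (P \<theta>) \<nu> q" if r: "r \<in> normalized_pairs X c" for r
  proof -
    have "(\<lambda>n. ((\<integral>x. fst r x \<partial>P (\<theta> + t (k n) *\<^sub>R v)) - (\<integral>x. fst r x \<partial>P \<theta>)) / t (k n))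
      \<longlonglongrightarrow> weighted_gradient X \<rho> \<theta> (fst r) \<bullet> v"
      by (rule source_quotient_tendsto[OF \<theta> t(1) tk seg props(1)[OF r] props(1)[OF r] props(2)[OF r] tendsto_const])
    from tendsto_mult[OF tk this]
    have "(\<lambda>n. (\<integral>x. fst r x \<partial>P (\<theta>n (k n))) - (\<integral>x. fst r x \<partial>P \<theta>)) \<longlonglongrightarrow> 0"
      using t(1) by (simp add: \<theta>n_def less_imp_neq[symmetric])
    from tendsto_add[OF this tendsto_const[of "dual_value (P \<theta>) \<nu> r"]]
    have "(\<lambda>n. dual_value (P (\<theta>n (k n))) \<nu> r) \<longlonglongrightarrow> dual_value (P \<theta>) \<nu> r"
      by (simp add: dual_value_def case_prod_unfold)
    then show ?thesis
      by (rule LIMSEQ_le[OF _ moving_lim])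
        (use max_p normalized_pairs_subset_dual_pairs r in \<open>auto simp: kantorovich_potentials_def\<close>)
  qed
  have "dual_value (P \<theta>) \<nu> r \<le> dual_value (P \<theta>) \<nu> q" if "r \<in> dual_pairs X c" for r
    by (rule dual_pair_improve[OF that source[OF \<theta>] target]) (erule order_trans, erule q_max)
  then have q_pot: "q \<in> kantorovich_potentials X c (P \<theta>) \<nu>"
    using q normalized_pairs_subset_dual_pairs by (auto simp: kantorovich_potentials_def)
  have "a \<le> weighted_gradient X \<rho> \<theta> (fst q) \<bullet> v"
  proof (rule LIMSEQ_le_const[OF Q], intro exI allI impI)
    fix n :: nat
    have "f (\<theta>n (k n)) = dual_value (P (\<theta>n (k n))) \<nu> (p (k n))"
      unfolding f[OF \<theta>n] by (rule transport_cost_eq_dual_value[OF source[OF \<theta>n] target max_p])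
    moreover have "dual_value (P \<theta>) \<nu> (p (k n)) \<le> f \<theta>"
      unfolding f[OF \<theta>] using norm_p[of "k n"] normalized_pairs_subset_dual_pairs
      by (intro dual_value_le_transport_cost source \<theta> target) auto
    ultimately have "f (\<theta>n (k n)) - f \<theta> \<le> t (k n) * Q n"
      using gap[of n] by simp
    then have "(f (\<theta>n (k n)) - f \<theta>) / t (k n) \<le> Q n"
      using t(1)[of "k n"] by (simp add: divide_le_eq mult.commute)
    then show "a \<le> Q n"
      using ge[of "k n"] unfolding \<theta>n_def by (rule order_trans[rotated])
  qed
  then show ?thesis
    using q q_pot by (auto simp: normalized_potentials_def)
qed

text \<open>The supremum of an unbounded set of reals would be unspecified.\<close>

lemma bdd_above_weighted_gradient:
  assumes \<theta>: "\<theta> \<in> \<Theta>"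
  shows "bdd_above ((\<lambda>(\<phi>, \<psi>). weighted_gradient X \<rho> \<theta> \<phi> \<bullet> v) ` normalized_potentials X c (P \<theta>) \<nu>)"
proof (rule bdd_aboveI2)
  fix p assume p: "p \<in> normalized_potentials X c (P \<theta>) \<nu>"
  obtain \<phi> \<psi> where p_eq: "p = (\<phi>, \<psi>)" by fastforce
  have norm: "(\<phi>, \<psi>) \<in> normalized_pairs X c" using p by (simp add: p_eq normalized_potentials_def)
  then have \<phi>: "continuous_on X \<phi>" and B: "\<And>x. x \<in> X \<Longrightarrow> \<bar>\<phi> x\<bar> \<le> sup_norm_on X c"
    by (auto simp: normalized_pairs_iff)
  have "weighted_gradient X \<rho> \<theta> \<phi> \<bullet> v \<le> norm (weighted_gradient X \<rho> \<theta> \<phi>) * norm v"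
    by (rule norm_cauchy_schwarz)
  also have "\<dots> \<le> (sup_norm_on X c * (\<integral>x. \<eta> x \<partial>lebesgue_on X)) * norm v"
    by (intro mult_right_mono norm_weighted_gradient_le[OF \<theta> \<phi> B]) auto
  finally show "(case p of (\<phi>, \<psi>) \<Rightarrow> weighted_gradient X \<rho> \<theta> \<phi> \<bullet> v)
      \<le> (sup_norm_on X c * (\<integral>x. \<eta> x \<partial>lebesgue_on X)) * norm v"
    by (simp add: p_eq)
qed

text \<open>Danskin's formula. A sequence \<open>t n \<rightarrow> 0\<close> along which the quotients stay below some number less than the
  supremum is excluded by \<open>potential_subgradient\<close>, and one along which they stay above some number
  greater than the supremum by \<open>limit_potential_bounds_quotient\<close>.\<close>

lemma directional_derivative_transport_cost:
  assumes f: "\<And>\<theta>. \<theta> \<in> \<Theta> \<Longrightarrow> f \<theta> = transport_cost X c (P \<theta>) \<nu>" and \<theta>: "\<theta> \<in> \<Theta>"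
  shows "((\<lambda>t. (f (\<theta> + t *\<^sub>R v) - f \<theta>) / t) \<longlongrightarrow>
    (SUP (\<phi>, \<psi>)\<in>normalized_potentials X c (P \<theta>) \<nu>. weighted_gradient X \<rho> \<theta> \<phi> \<bullet> v)) (at_right 0)"
    (is "(?q \<longlongrightarrow> ?L) _")
proof -
  let ?S = "normalized_potentials X c (P \<theta>) \<nu>"
  have ne: "?S \<noteq> {}"
    using normalized_potentials_nonempty[OF source[OF \<theta>] target bdd_above_dual_value[OF source[OF \<theta>] target]]
    by blast
  note bdd = bdd_above_weighted_gradient[OF \<theta>, of v]
  obtain d where d: "0 < d" and seg: "\<And>t. 0 < t \<and> t < d \<Longrightarrow> closed_segment \<theta> (\<theta> + t *\<^sub>R v) \<subseteq> \<Theta>"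
    using segment_in_parameters[OF \<theta>, of v] by auto
  show ?thesis
  proof (rule order_tendstoI)
    fix a assume "a < ?L"
    then obtain \<phi> \<psi> where p: "(\<phi>, \<psi>) \<in> ?S" and a: "a < weighted_gradient X \<rho> \<theta> \<phi> \<bullet> v"
      unfolding less_cSUP_iff[OF ne bdd] by auto
    show "eventually (\<lambda>t. a < ?q t) (at_right 0)"
    proof (rule ccontr)
      assume "\<not> ?thesis"
      then obtain t :: "nat \<Rightarrow> real"
        where "\<forall>n. 0 < t n \<and> t n < d \<and> \<not> a < ?q (t n)" and t0: "t \<longlonglongrightarrow> 0"
        using not_eventually_at_right_sequence[OF _ d] by auto
      then have t: "0 < t n" "t n < d" "\<not> a < ?q (t n)" for n by auto
      have "weighted_gradient X \<rho> \<theta> \<phi> \<bullet> v \<le> a"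
      proof (rule potential_subgradient[OF f \<theta> _ t(1) t0])
        show "(\<phi>, \<psi>) \<in> kantorovich_potentials X c (P \<theta>) \<nu>"
          using p by (simp add: normalized_potentials_def)
        show "closed_segment \<theta> (\<theta> + t n *\<^sub>R v) \<subseteq> \<Theta>" for n
          using seg t(1,2) by blast
        show "?q (t n) \<le> a" for n
          using t(3)[of n] by simp
      qed
      with a show False by simp
    qed
  next
    fix a assume a: "?L < a"
    show "eventually (\<lambda>t. ?q t < a) (at_right 0)"
    proof (rule ccontr)
      assume "\<not> ?thesis"
      then obtain t :: "nat \<Rightarrow> real"
        where "\<forall>n. 0 < t n \<and> t n < d \<and> \<not> ?q (t n) < a" and t0: "t \<longlonglongrightarrow> 0"
        using not_eventually_at_right_sequence[OF _ d] by auto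
      then have t: "0 < t n" "t n < d" "\<not> ?q (t n) < a" for n by auto
      have "\<exists>q\<in>?S. a \<le> weighted_gradient X \<rho> \<theta> (fst q) \<bullet> v"
      proof (rule limit_potential_bounds_quotient[OF f \<theta> t(1) t0])
        show "closed_segment \<theta> (\<theta> + t n *\<^sub>R v) \<subseteq> \<Theta>" for n
          using seg t(1,2) by blast
        show "a \<le> ?q (t n)" for n
          using t(3)[of n] by simp
      qed
      then obtain q where "q \<in> ?S" "a \<le> weighted_gradient X \<rho> \<theta> (fst q) \<bullet> v" by blast
      then have "a \<le> ?L"
        by (intro cSUP_upper2[OF bdd]) (auto simp: case_prod_unfold)
      with a show False by simp
    qed
  qed
qed

lemma potential_le_dir_deriv:
  assumes f: "\<And>\<theta>. \<theta> \<in> \<Theta> \<Longrightarrow> f \<theta> = transport_cost X c (P \<theta>) \<nu>" and \<theta>: "\<theta> \<in> \<Theta>"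
    and p: "(\<phi>, \<psi>) \<in> kantorovich_potentials X c (P \<theta>) \<nu>"
    and L: "((\<lambda>t. (f (\<theta> + t *\<^sub>R v) - f \<theta>) / t) \<longlongrightarrow> L) (at_right 0)"
  shows "weighted_gradient X \<rho> \<theta> \<phi> \<bullet> v \<le> L"
proof (rule dense_ge)
  fix a assume "L < a"
  then have "eventually (\<lambda>t. (f (\<theta> + t *\<^sub>R v) - f \<theta>) / t < a) (at_right 0)"
    by (rule order_tendstoD(2)[OF L])
  then obtain b where b: "0 < b" "\<And>t. 0 < t \<Longrightarrow> t < b \<Longrightarrow> (f (\<theta> + t *\<^sub>R v) - f \<theta>) / t < a"
    unfolding eventually_at_right_field by auto
  obtain d where d: "0 < d" and seg: "\<And>t. 0 < t \<and> t < d \<Longrightarrow> closed_segment \<theta> (\<theta> + t *\<^sub>R v) \<subseteq> \<Theta>"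
    using segment_in_parameters[OF \<theta>, of v] by auto
  have "0 < min b d" using b d by simp
  moreover have "\<not> eventually (\<lambda>t. False) (at_right (0 :: real))" by simp
  ultimately obtain t :: "nat \<Rightarrow> real" where "\<forall>n. 0 < t n \<and> t n < min b d" and t0: "t \<longlonglongrightarrow> 0"
    using not_eventually_at_right_sequence[of "\<lambda>_. False" "min b d"] by auto
  then have t: "0 < t n" "t n < min b d" for n by auto
  show "weighted_gradient X \<rho> \<theta> \<phi> \<bullet> v \<le> a"
  proof (rule potential_subgradient[OF f \<theta> p t(1) t0])
    show "closed_segment \<theta> (\<theta> + t n *\<^sub>R v) \<subseteq> \<Theta>" for n
      using seg[of "t n"] t(1,2)[of n] by simp
    show "(f (\<theta> + t n *\<^sub>R v) - f \<theta>) / t n \<le> a" for n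
      using b(2)[of "t n"] t(1,2)[of n] by simp
  qed
qed

lemma dir_deriv_transport_cost:
  assumes f: "\<And>\<theta>. \<theta> \<in> \<Theta> \<Longrightarrow> f \<theta> = transport_cost X c (P \<theta>) \<nu>" and \<theta>: "\<theta> \<in> \<Theta>"
  shows "directionally_differentiable f \<theta>"
    and "dir_deriv f \<theta> v =
      (SUP (\<phi>, \<psi>)\<in>normalized_potentials X c (P \<theta>) \<nu>. weighted_gradient X \<rho> \<theta> \<phi> \<bullet> v)"
  using directional_derivative_transport_cost[OF f \<theta>]
  by (auto simp: directionally_differentiable_def dir_deriv_def intro!: tendsto_Lim)

text \<open>For a linear derivative, the lower bound in direction \<open>-v\<close> is the upper bound in direction \<open>v\<close>.\<close>

lemma weighted_gradient_eq_if_gateaux: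
  assumes f: "\<And>\<theta>. \<theta> \<in> \<Theta> \<Longrightarrow> f \<theta> = transport_cost X c (P \<theta>) \<nu>" and \<theta>: "\<theta> \<in> \<Theta>"
    and lin: "linear (dir_deriv f \<theta>)"
    and p: "(\<phi>, \<psi>) \<in> kantorovich_potentials X c (P \<theta>) \<nu>"
  shows "dir_deriv f \<theta> v = weighted_gradient X \<rho> \<theta> \<phi> \<bullet> v"
proof -
  have le: "weighted_gradient X \<rho> \<theta> \<phi> \<bullet> v \<le> dir_deriv f \<theta> v" for v
  proof -
    have "weighted_gradient X \<rho> \<theta> \<phi> \<bullet> v
        \<le> (SUP (\<phi>, \<psi>)\<in>normalized_potentials X c (P \<theta>) \<nu>. weighted_gradient X \<rho> \<theta> \<phi> \<bullet> v)"
      by (rule potential_le_dir_deriv[of f, OF f \<theta> p directional_derivative_transport_cost[of f, OF f \<theta>]])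
    also have "\<dots> = dir_deriv f \<theta> v"
      by (rule dir_deriv_transport_cost(2)[of f, OF f \<theta>, symmetric])
    finally show ?thesis .
  qed
  show ?thesis
    using le[of v] le[of "- v"] linear_neg[OF lin, of v] by simp
qed

lemma gateaux_differentiable_transport_cost_iff:
  assumes f: "\<And>\<theta>. \<theta> \<in> \<Theta> \<Longrightarrow> f \<theta> = transport_cost X c (P \<theta>) \<nu>" and \<theta>: "\<theta> \<in> \<Theta>"
  shows "gateaux_differentiable f \<theta> \<longleftrightarrow>
    (\<forall>(\<phi>\<^sub>1, \<psi>\<^sub>1)\<in>normalized_potentials X c (P \<theta>) \<nu>. \<forall>(\<phi>\<^sub>2, \<psi>\<^sub>2)\<in>normalized_potentials X c (P \<theta>) \<nu>.
       weighted_gradient X \<rho> \<theta> \<phi>\<^sub>1 = weighted_gradient X \<rho> \<theta> \<phi>\<^sub>2)" (is "_ \<longleftrightarrow> ?unique")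
proof
  assume "gateaux_differentiable f \<theta>"
  then have lin: "linear (dir_deriv f \<theta>)" by (simp add: gateaux_differentiable_def)
  have "weighted_gradient X \<rho> \<theta> \<phi>\<^sub>1 = weighted_gradient X \<rho> \<theta> \<phi>\<^sub>2"
    if "(\<phi>\<^sub>1, \<psi>\<^sub>1) \<in> normalized_potentials X c (P \<theta>) \<nu>" "(\<phi>\<^sub>2, \<psi>\<^sub>2) \<in> normalized_potentials X c (P \<theta>) \<nu>"
    for \<phi>\<^sub>1 \<psi>\<^sub>1 \<phi>\<^sub>2 \<psi>\<^sub>2
  proof -
    have "weighted_gradient X \<rho> \<theta> \<phi>\<^sub>1 \<bullet> v = weighted_gradient X \<rho> \<theta> \<phi>\<^sub>2 \<bullet> v" for v
      using that weighted_gradient_eq_if_gateaux[of f, OF f \<theta> lin, of \<phi>\<^sub>1 \<psi>\<^sub>1 v]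
        weighted_gradient_eq_if_gateaux[of f, OF f \<theta> lin, of \<phi>\<^sub>2 \<psi>\<^sub>2 v]
      by (simp add: normalized_potentials_def)
    then show ?thesis by (simp add: euclidean_eq_iff[of "weighted_gradient X \<rho> \<theta> \<phi>\<^sub>1"])
  qed
  then show ?unique by blast
next
  assume ?unique
  obtain \<phi> \<psi> where p: "(\<phi>, \<psi>) \<in> normalized_potentials X c (P \<theta>) \<nu>"
    by (rule normalized_potentials_nonempty[OF source[OF \<theta>] target bdd_above_dual_value[OF source[OF \<theta>] target]]) fastforce
  have "dir_deriv f \<theta> v = weighted_gradient X \<rho> \<theta> \<phi> \<bullet> v" for v
  proof -
    have "(SUP (\<phi>, \<psi>)\<in>normalized_potentials X c (P \<theta>) \<nu>. weighted_gradient X \<rho> \<theta> \<phi> \<bullet> v)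
        = (SUP p\<in>normalized_potentials X c (P \<theta>) \<nu>. weighted_gradient X \<rho> \<theta> \<phi> \<bullet> v)"
    proof (intro SUP_cong refl)
      fix q assume q: "q \<in> normalized_potentials X c (P \<theta>) \<nu>"
      have "weighted_gradient X \<rho> \<theta> (fst q) = weighted_gradient X \<rho> \<theta> \<phi>"
        using bspec[OF bspec[OF \<open>?unique\<close> q, unfolded case_prod_unfold] p] by simp
      then show "(case q of (\<phi>, \<psi>) \<Rightarrow> weighted_gradient X \<rho> \<theta> \<phi> \<bullet> v) = weighted_gradient X \<rho> \<theta> \<phi> \<bullet> v"
        by (simp add: case_prod_unfold)
    qed
    also have "\<dots> = weighted_gradient X \<rho> \<theta> \<phi> \<bullet> v"
      using p by (intro cSUP_const) blast
    finally show ?thesis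
      using dir_deriv_transport_cost(2)[of f, OF f \<theta>] by (rule trans[rotated])
  qed
  then have "dir_deriv f \<theta> = (\<lambda>v. weighted_gradient X \<rho> \<theta> \<phi> \<bullet> v)"
    by (rule ext)
  moreover have "linear (\<lambda>v. weighted_gradient X \<rho> \<theta> \<phi> \<bullet> v)"
    by (rule bounded_linear.linear[OF bounded_linear_inner_right])
  ultimately show "gateaux_differentiable f \<theta>"
    using dir_deriv_transport_cost(1)[of f, OF f \<theta>] by (simp add: gateaux_differentiable_def)
qed

lemma gateaux_gradient_transport_cost:
  assumes f: "\<And>\<theta>. \<theta> \<in> \<Theta> \<Longrightarrow> f \<theta> = transport_cost X c (P \<theta>) \<nu>" and \<theta>: "\<theta> \<in> \<Theta>"
    and diff: "gateaux_differentiable f \<theta>"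
    and p: "(\<phi>, \<psi>) \<in> kantorovich_potentials X c (P \<theta>) \<nu>"
  shows "gateaux_gradient f \<theta> = weighted_gradient X \<rho> \<theta> \<phi>"
  unfolding gateaux_gradient_def
proof (rule the_equality)
  have lin: "linear (dir_deriv f \<theta>)" using diff by (simp add: gateaux_differentiable_def)
  note eq = weighted_gradient_eq_if_gateaux[of f, OF f \<theta> lin p]
  show "\<forall>v. dir_deriv f \<theta> v = weighted_gradient X \<rho> \<theta> \<phi> \<bullet> v"
    using eq by blast
  fix g assume "\<forall>v. dir_deriv f \<theta> v = g \<bullet> v"
  then show "g = weighted_gradient X \<rho> \<theta> \<phi>"
    using eq by (simp add: euclidean_eq_iff[of g])
qed

end

theorem proposition4p1:
  fixes \<Omega> :: "(real ^ 'd) set"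
    and \<Theta> :: "(real ^ 'm) set"
    and P :: "real ^ 'm \<Rightarrow> (real ^ 'd) measure"
    and \<rho> :: "real ^ 'd \<Rightarrow> real ^ 'm \<Rightarrow> real"
    and \<rho>' :: "(real ^ 'd) measure"
    and \<eta> :: "real ^ 'd \<Rightarrow> real"
    and c :: "real ^ 'd \<Rightarrow> real ^ 'd \<Rightarrow> real"
    and f :: "real ^ 'm \<Rightarrow> real"
  assumes "compact \<Omega>"
    and "\<rho>' \<in> borel_prob \<Omega>"
    and A1: "open \<Theta>"
      "\<And>\<theta>. \<theta> \<in> \<Theta> \<Longrightarrow> P \<theta> \<in> borel_prob \<Omega>"
      "\<And>\<theta>. \<theta> \<in> \<Theta> \<Longrightarrow> has_lebesgue_density \<Omega> (P \<theta>) (\<lambda>x. \<rho> x \<theta>)"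
    and A2: "integrable (lebesgue_on \<Omega>) \<eta>"
      "AE x in lebesgue_on \<Omega>. \<forall>\<theta>\<in>\<Theta>. \<rho> x differentiable (at \<theta>) \<and> norm (gradient (\<rho> x) \<theta>) \<le> \<eta> x"
    and A3: "continuous_on (\<Omega> \<times> \<Omega>) (\<lambda>(x, y). c x y)"
      "\<And>x y. x \<in> \<Omega> \<Longrightarrow> y \<in> \<Omega> \<Longrightarrow> 0 \<le> c x y"
    and f: "\<And>\<theta>. \<theta> \<in> \<Theta> \<Longrightarrow> f \<theta> = transport_cost \<Omega> c (P \<theta>) \<rho>'"
  shows "(\<forall>\<theta>\<^sub>0\<in>\<Theta>. directionally_differentiable f \<theta>\<^sub>0 \<and>
            (\<forall>\<Delta>. dir_deriv f \<theta>\<^sub>0 \<Delta> =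
               (SUP (\<phi>, \<psi>)\<in>normalized_potentials \<Omega> c (P \<theta>\<^sub>0) \<rho>'.
                  weighted_gradient \<Omega> \<rho> \<theta>\<^sub>0 \<phi> \<bullet> \<Delta>))) \<and>
         (\<forall>\<theta>\<^sub>0\<in>\<Theta>.
            (gateaux_differentiable f \<theta>\<^sub>0 \<longleftrightarrow>
               (\<forall>(\<phi>\<^sub>1, \<psi>\<^sub>1)\<in>normalized_potentials \<Omega> c (P \<theta>\<^sub>0) \<rho>'.
                \<forall>(\<phi>\<^sub>2, \<psi>\<^sub>2)\<in>normalized_potentials \<Omega> c (P \<theta>\<^sub>0) \<rho>'.
                  weighted_gradient \<Omega> \<rho> \<theta>\<^sub>0 \<phi>\<^sub>1 = weighted_gradient \<Omega> \<rho> \<theta>\<^sub>0 \<phi>\<^sub>2)) \<and>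
            (gateaux_differentiable f \<theta>\<^sub>0 \<longrightarrow>
               (\<forall>(\<phi>, \<psi>)\<in>kantorovich_potentials \<Omega> c (P \<theta>\<^sub>0) \<rho>'.
                  gateaux_gradient f \<theta>\<^sub>0 = weighted_gradient \<Omega> \<rho> \<theta>\<^sub>0 \<phi>)))"
proof (cases "\<Theta> = {}")
  case False
  then have "\<Omega> \<noteq> {}"
    using A1(2) prob_space.not_empty by (fastforce simp: borel_prob_def)
  then interpret transport_family \<Omega> c \<Theta> P \<rho> \<rho>' \<eta>
    using assms by unfold_locales auto
  show ?thesis
  proof (intro conjI ballI allI impI)
    fix \<theta>\<^sub>0 \<Delta> assume \<theta>\<^sub>0: "\<theta>\<^sub>0 \<in> \<Theta>"
    show "directionally_differentiable f \<theta>\<^sub>0"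
      by (rule dir_deriv_transport_cost(1)[of f, OF f \<theta>\<^sub>0])
    show "dir_deriv f \<theta>\<^sub>0 \<Delta> =
        (SUP (\<phi>, \<psi>)\<in>normalized_potentials \<Omega> c (P \<theta>\<^sub>0) \<rho>'. weighted_gradient \<Omega> \<rho> \<theta>\<^sub>0 \<phi> \<bullet> \<Delta>)"
      by (rule dir_deriv_transport_cost(2)[of f, OF f \<theta>\<^sub>0])
  next
    fix \<theta>\<^sub>0 assume \<theta>\<^sub>0: "\<theta>\<^sub>0 \<in> \<Theta>"
    show "gateaux_differentiable f \<theta>\<^sub>0 \<longleftrightarrow>
       (\<forall>(\<phi>\<^sub>1, \<psi>\<^sub>1)\<in>normalized_potentials \<Omega> c (P \<theta>\<^sub>0) \<rho>'.
        \<forall>(\<phi>\<^sub>2, \<psi>\<^sub>2)\<in>normalized_potentials \<Omega> c (P \<theta>\<^sub>0) \<rho>'.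
          weighted_gradient \<Omega> \<rho> \<theta>\<^sub>0 \<phi>\<^sub>1 = weighted_gradient \<Omega> \<rho> \<theta>\<^sub>0 \<phi>\<^sub>2)"
      by (rule gateaux_differentiable_transport_cost_iff[of f, OF f \<theta>\<^sub>0])
  next
    fix \<theta>\<^sub>0 p assume "\<theta>\<^sub>0 \<in> \<Theta>" "gateaux_differentiable f \<theta>\<^sub>0"
      "p \<in> kantorovich_potentials \<Omega> c (P \<theta>\<^sub>0) \<rho>'"
    then show "case p of (\<phi>, \<psi>) \<Rightarrow> gateaux_gradient f \<theta>\<^sub>0 = weighted_gradient \<Omega> \<rho> \<theta>\<^sub>0 \<phi>"
      using gateaux_gradient_transport_cost[of f, OF f] by (cases p) auto
  qed
qed simp

end
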